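(* Let $M$ be a bDD matrix with index set $V$ ($|V|=n$), and let $F\subseteq V$ be such that $M_{[F,F]}$ is $\alpha$-bDD for some $\alpha\ge 4$ and has $m_{FF}$ nonzero blocks. The algorithm $\textsc{Jacobi}(\epsilon,M_{[F,F]},b)$ acts as a linear operator $Z$ on $b$ that satisfies \[0\preceq Z^{-1}-M_{[F,F]}\preceq \epsilon\cdot \mathrm{Sc}(M,V\setminus F).\] The algorithm takes $O(m_{FF}\log(1/\epsilon))$ work and $O(\log n\log(1/\epsilon))$ depth.
   Context: Fix a constant integer $r>0$; block matrices have $r\times r$ complex blocks $M_{[i,j]}$, and $M_{[S,T]}$ denotes the block submatrix with block rows in $S$ and block columns in $T$. A Hermitian block matrix $M$ is bDD if $M_{[i,i]}\succeq I_r\sum_{j\ne i}\|M_{[i,j]}\|$ for all $i$, and $\alpha$-bDD if $M_{[i,i]}\succeq(1+\alpha)I_r\sum_{j\ne i}\|M_{[i,j]}\|$ for all $i$ ($\|\cdot\|$ operator norm). For a partition $V=F\cup C$, the Schur complement eliminating $C$ is $\mathrm{Sc}(M,C)=M_{[F,F]}-M_{[F,C]}M_{[C,C]}^{-1}M_{[C,F]}$ (so $\mathrm{Sc}(M,V\setminus F)$ is a matrix indexed by $F$). Algorithm $\textsc{Jacobi}(\epsilon,N,b)$, for a Hermitian block matrix $N$: (1) form $L$ with $L_{[i,i]}=I_r\sum_{j\ne i}\|N_{[i,j]}\|$ and $L_{[i,j]}=N_{[i,j]}$ for $i\neq j$; (2) set $X=N-L$ (block diagonal); (3) let $k$ be an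 odd integer greater than $\log(3/\epsilon)$; (4) set $x^{(0)}=X^{-1}b$; (5) for $i=1,\dots,k$ set $x^{(i)}=-X^{-1}Lx^{(i-1)}+X^{-1}b$; (6) return $x^{(k)}$. *)

theory Defs
  imports "HOL-Analysis.Analysis" "HOL-Library.Monad_Syntax"
begin

section \<open>Block matrices\<close>

text \<open>
  The block size is \<open>r = CARD('r)\<close>.  A block matrix with block rows in \<open>S\<close> and block columns in
  \<open>T\<close> (finite sets of natural numbers) is a function that vanishes outside \<open>S \<times> T\<close>, and a block
  vector is a function on indices.
\<close>

type_synonym 'r block = "complex^'r^'r"
type_synonym 'r bmat = "nat \<Rightarrow> nat \<Rightarrow> 'r block"
type_synonym 'r bvec = "nat \<Rightarrow> complex^'r"

definition bmats :: "nat set \<Rightarrow> nat set \<Rightarrow> ('r::finite) bmat set" where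
  "bmats S T = {A. \<forall>i j. i \<notin> S \<or> j \<notin> T \<longrightarrow> A i j = 0}"

definition submat :: "('r::finite) bmat \<Rightarrow> nat set \<Rightarrow> nat set \<Rightarrow> 'r bmat" where
  "submat M S T = (\<lambda>i j. if i \<in> S \<and> j \<in> T then M i j else 0)"

text \<open>In \<open>bmat_mult T A B\<close> and \<open>bmat_vec T A x\<close>, \<open>T\<close> is the index set that is summed over.\<close>

definition bmat_mult :: "nat set \<Rightarrow> ('r::finite) bmat \<Rightarrow> 'r bmat \<Rightarrow> 'r bmat" where
  "bmat_mult T A B = (\<lambda>i k. \<Sum>j\<in>T. A i j ** B j k)"

definition bmat_vec :: "nat set \<Rightarrow> ('r::finite) bmat \<Rightarrow> 'r bvec \<Rightarrow> 'r bvec" where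
  "bmat_vec T A x = (\<lambda>i. \<Sum>j\<in>T. A i j *v x j)"

definition bmat_id :: "nat set \<Rightarrow> ('r::finite) bmat" where
  "bmat_id S = (\<lambda>i j. if i = j \<and> i \<in> S then mat 1 else 0)"

definition is_bmat_inv :: "nat set \<Rightarrow> ('r::finite) bmat \<Rightarrow> 'r bmat \<Rightarrow> bool" where
  "is_bmat_inv S A B \<longleftrightarrow>
     B \<in> bmats S S \<and> bmat_mult S A B = bmat_id S \<and> bmat_mult S B A = bmat_id S"

definition bmat_invertible :: "nat set \<Rightarrow> ('r::finite) bmat \<Rightarrow> bool" where
  "bmat_invertible S A \<longleftrightarrow> (\<exists>B. is_bmat_inv S A B)"

definition bmat_inv :: "nat set \<Rightarrow> ('r::finite) bmat \<Rightarrow> 'r bmat" where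
  "bmat_inv S A = (SOME B. is_bmat_inv S A B)"

definition nnz_blocks :: "nat set \<Rightarrow> ('r::finite) bmat \<Rightarrow> nat" where
  "nnz_blocks S A = card {(i, j). i \<in> S \<and> j \<in> S \<and> A i j \<noteq> 0}"


section \<open>Hermitian matrices and the Loewner order\<close>

definition cinner :: "complex^('r::finite) \<Rightarrow> complex^'r \<Rightarrow> complex" where
  "cinner x y = (\<Sum>l\<in>UNIV. cnj (x $ l) * y $ l)"

definition conj_transpose :: "('r::finite) block \<Rightarrow> 'r block" where
  "conj_transpose A = (\<chi> i j. cnj (A $ j $ i))"

definition psd_block :: "('r::finite) block \<Rightarrow> bool" where
  "psd_block A \<longleftrightarrow> conj_transpose A = A \<and> (\<forall>v. 0 \<le> Re (cinner v (A *v v)))"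

definition hermitian :: "nat set \<Rightarrow> ('r::finite) bmat \<Rightarrow> bool" where
  "hermitian S A \<longleftrightarrow> (\<forall>i\<in>S. \<forall>j\<in>S. A i j = conj_transpose (A j i))"

definition psd :: "nat set \<Rightarrow> ('r::finite) bmat \<Rightarrow> bool" where
  "psd S A \<longleftrightarrow>
     hermitian S A \<and> (\<forall>x. 0 \<le> Re (\<Sum>i\<in>S. \<Sum>j\<in>S. cinner (x i) (A i j *v x j)))"

definition loewner_le :: "nat set \<Rightarrow> ('r::finite) bmat \<Rightarrow> 'r bmat \<Rightarrow> bool" where
  "loewner_le S A B \<longleftrightarrow> psd S (\<lambda>i j. B i j - A i j)"


section \<open>Block diagonal dominance and Schur complements\<close>

text \<open>
  The type class operation \<open>norm\<close> on \<open>'r block\<close> is the Frobenius norm, so the operator norm (for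
  the Euclidean norm on vectors) has to be taken through \<open>onorm\<close>.
\<close>

definition opnorm :: "('r::finite) block \<Rightarrow> real" where
  "opnorm A = onorm (\<lambda>v. A *v v)"

definition offdiag_norm :: "nat set \<Rightarrow> ('r::finite) bmat \<Rightarrow> nat \<Rightarrow> real" where
  "offdiag_norm S A i = (\<Sum>j\<in>S - {i}. opnorm (A i j))"

definition bDD :: "nat set \<Rightarrow> ('r::finite) bmat \<Rightarrow> bool" where
  "bDD S A \<longleftrightarrow>
     hermitian S A \<and> (\<forall>i\<in>S. psd_block (A i i - offdiag_norm S A i *\<^sub>R mat 1))"

definition alpha_bDD :: "real \<Rightarrow> nat set \<Rightarrow> ('r::finite) bmat \<Rightarrow> bool" where
  "alpha_bDD \<alpha> S A \<longleftrightarrow>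
     hermitian S A \<and> (\<forall>i\<in>S. psd_block (A i i - ((1 + \<alpha>) * offdiag_norm S A i) *\<^sub>R mat 1))"

text \<open>\<open>schur V M C\<close> eliminates \<open>C\<close>; it is meaningful when \<open>submat M C C\<close> is invertible.\<close>

definition schur :: "nat set \<Rightarrow> ('r::finite) bmat \<Rightarrow> nat set \<Rightarrow> 'r bmat" where
  "schur V M C = (let F = V - C in (\<lambda>i j. submat M F F i j -
     bmat_mult C (submat M F C) (bmat_mult C (bmat_inv C (submat M C C)) (submat M C F)) i j))"


section \<open>Work and depth of parallel computations\<close>

text \<open>
  A computation carries its result together with its work and depth.  The unit-cost instructions
  (\<open>tick\<close>) read a bounded number of memory cells and perform one operation on \<open>r \<times> r\<close> blocks,
  vectors of length \<open>r\<close> or scalars; \<open>r\<close> is a constant.  The only source of parallelism is the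
  binary \<open>fork\<close>, so the logarithmic depth of loops and sums below is derived from the fork trees.
  \<open>ret\<close> merely names a value that has already been computed.
\<close>

datatype 'a comp = Comp (result: 'a) (work: nat) (depth: nat)

definition ret :: "'a \<Rightarrow> 'a comp" where
  "ret x = Comp x 0 0"

definition tick :: "'a \<Rightarrow> 'a comp" where
  "tick x = Comp x 1 1"

definition bind_comp :: "'a comp \<Rightarrow> ('a \<Rightarrow> 'b comp) \<Rightarrow> 'b comp" where
  "bind_comp m f = (let m' = f (result m) in
     Comp (result m') (work m + work m') (depth m + depth m'))"

adhoc_overloading Monad_Syntax.bind \<rightleftharpoons> bind_comp

definition fork :: "'a comp \<Rightarrow> 'b comp \<Rightarrow> ('a \<times> 'b) comp" where
  "fork m m' = Comp (result m, result m') (work m + work m' + 1) (max (depth m) (depth m') + 1)"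

text \<open>
  \<open>par_for f is\<close> runs \<open>f i\<close> for all \<open>i\<close> in the index array \<open>is\<close> in parallel and stores the results
  in an array indexed by \<open>is\<close>.  The two halves write to disjoint cells of that array, so joining
  them is free.
\<close>

fun par_for :: "('i \<Rightarrow> ('a::zero) comp) \<Rightarrow> 'i list \<Rightarrow> ('i \<Rightarrow> 'a) comp" where
  "par_for f [] = ret (\<lambda>_. 0)"
| "par_for f [i] = do { y \<leftarrow> f i; ret ((\<lambda>_. 0)(i := y)) }"
| "par_for f (i # j # is) =
     (let xs = i # j # is; h = length xs div 2 in do {
        (u, v) \<leftarrow> fork (par_for f (take h xs)) (par_for f (drop h xs));
        ret (override_on u v (set (drop h xs))) })"

fun par_sum :: "('i \<Rightarrow> ('a::comm_monoid_add) comp) \<Rightarrow> 'i list \<Rightarrow> 'a comp" where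
  "par_sum f [] = ret 0"
| "par_sum f [i] = f i"
| "par_sum f (i # j # is) =
     (let xs = i # j # is; h = length xs div 2 in do {
        (s, t) \<leftarrow> fork (par_sum f (take h xs)) (par_sum f (drop h xs));
        tick (s + t) })"


section \<open>The Jacobi algorithm\<close>

text \<open>
  Sparse representation of a block matrix \<open>N\<close> on \<open>F\<close>: an array \<open>fs\<close> of the indices, and for every
  row \<open>i\<close> an array \<open>nb i\<close> of the columns of its nonzero off-diagonal blocks.
\<close>

definition sparse_repr ::
    "nat set \<Rightarrow> ('r::finite) bmat \<Rightarrow> nat list \<Rightarrow> (nat \<Rightarrow> nat list) \<Rightarrow> bool" where
  "sparse_repr F N fs nb \<longleftrightarrow> distinct fs \<and> set fs = F \<and>
     (\<forall>i\<in>F. distinct (nb i) \<and> set (nb i) = {j \<in> F. j \<noteq> i \<and> N i j \<noteq> 0})"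

text \<open>One sweep computes \<open>- X\<inverse> L x + X\<inverse> b\<close>, where \<open>Y i\<close> is the inverse of the \<open>i\<close>-th block of \<open>X\<close>.\<close>

definition jacobi_sweep ::
    "nat list \<Rightarrow> (nat \<Rightarrow> nat list) \<Rightarrow> ('r::finite) bmat \<Rightarrow> (nat \<Rightarrow> 'r block) \<Rightarrow> 'r bvec \<Rightarrow> 'r bvec
      \<Rightarrow> 'r bvec comp" where
  "jacobi_sweep fs nb L Y b x = par_for (\<lambda>i. do {
     s \<leftarrow> par_sum (\<lambda>j. tick (L i j *v x j)) (i # nb i);
     u \<leftarrow> tick (Y i *v s);
     w \<leftarrow> tick (Y i *v b i);
     tick (- u + w) }) fs"

primrec jacobi_loop ::
    "nat \<Rightarrow> nat list \<Rightarrow> (nat \<Rightarrow> nat list) \<Rightarrow> ('r::finite) bmat \<Rightarrow> (nat \<Rightarrow> 'r block) \<Rightarrow> 'r bvec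
      \<Rightarrow> 'r bvec \<Rightarrow> 'r bvec comp" where
  "jacobi_loop 0 fs nb L Y b x = ret x"
| "jacobi_loop (Suc t) fs nb L Y b x = do {
     x' \<leftarrow> jacobi_sweep fs nb L Y b x;
     jacobi_loop t fs nb L Y b x' }"

text \<open>
  The accuracy \<open>\<epsilon>\<close> enters the algorithm only through the number \<open>k\<close> of sweeps.  The off-diagonal
  blocks of \<open>L\<close> are those of \<open>N\<close> and are not copied.
\<close>

definition iteration_count :: "real \<Rightarrow> nat \<Rightarrow> bool" where
  "iteration_count \<epsilon> k \<longleftrightarrow> odd k \<and> log 2 (3 / \<epsilon>) < real k"

definition jacobi ::
    "nat \<Rightarrow> nat list \<Rightarrow> (nat \<Rightarrow> nat list) \<Rightarrow> ('r::finite) bmat \<Rightarrow> 'r bvec \<Rightarrow> 'r bvec comp" where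
  "jacobi k\<^sub>0 fs nb N b = do {
     d \<leftarrow> par_for (\<lambda>i. do {
            s \<leftarrow> par_sum (\<lambda>j. tick (opnorm (N i j))) (nb i);
            tick (s *\<^sub>R mat 1) }) fs;
     L \<leftarrow> ret (\<lambda>i j. if i = j then d i else N i j);
     X \<leftarrow> par_for (\<lambda>i. tick (N i i - L i i)) fs;
     Y \<leftarrow> par_for (\<lambda>i. tick (matrix_inv (X i))) fs;
     k \<leftarrow> tick k\<^sub>0;
     x \<leftarrow> par_for (\<lambda>i. tick (Y i *v b i)) fs;
     jacobi_loop k fs nb L Y b x }"

text \<open>
  The block diagonal matrix \<open>X = N - L\<close> as a matrix on \<open>F\<close>; the algorithm is well defined only
  when it is invertible.
\<close>

definition jacobi_L :: "nat set \<Rightarrow> ('r::finite) bmat \<Rightarrow> 'r bmat" where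
  "jacobi_L F N = submat (\<lambda>i j. if i = j then offdiag_norm F N i *\<^sub>R mat 1 else N i j) F F"

definition jacobi_X :: "nat set \<Rightarrow> ('r::finite) bmat \<Rightarrow> 'r bmat" where
  "jacobi_X F N = (\<lambda>i j. submat N F F i j - jacobi_L F N i j)"

end

theory Submission
  imports Defs "HOL-Library.Function_Algebras" "HOL-Computational_Algebra.Polynomial"
begin

text \<open>
  Split \<open>N = X + L\<close>.  Dominance with \<open>\<alpha> \<ge> 4\<close> makes \<open>T = X\<inverse> L\<close> self-adjoint for the form
  \<open>B(x, y) = \<langle>x, X y\<rangle>\<close> with spectrum in \<open>[0, 1/2]\<close>, and the iteration computes \<open>Z = p(T) X\<inverse>\<close> where
  \<open>(1 + t) p(t) = 1 - t ^ (k + 1)\<close> because \<open>k\<close> is odd.  For \<open>v = p(T) w\<close> this gives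
  \<open>\<langle>v, (Z\<inverse> - N) v\<rangle> = B(p(T) w, T ^ (k + 1) w)\<close>, which lies between \<open>0\<close> and
  \<open>2 \<sqdot> 2 ^ (- k) B(v, T v) = 2 \<sqdot> 2 ^ (- k) \<langle>v, L v\<rangle>\<close>.  Finally \<open>M\<close> minus \<open>L\<close> on the \<open>F\<close>-block is
  still bDD, hence positive semidefinite; evaluating it at the vector that extends \<open>x\<close> harmonically
  to \<open>V - F\<close> yields \<open>\<langle>x, L x\<rangle> \<le> \<langle>x, Sc(M, V - F) x\<rangle>\<close>.
\<close>

section \<open>Polynomials in a self-adjoint operator\<close>

text \<open>The error is measured against \<open>L\<close> rather than \<open>X\<close> or
  \<open>N\<close>: the Schur complement lies below \<open>N\<close> and may be singular, so a bound
  by a small multiple of \<open>N\<close> would prove nothing, whereas \<open>L\<close> lies below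
  the Schur complement. Hence only \<open>k\<close> of the \<open>k + 1\<close> factors of
  \<open>T\<close> in the error pay for the smallness \<open>2 ^ (- k)\<close>; one is kept, because
  \<open>B(v, T v)\<close> is the form of \<open>L\<close>. The interval \<open>[0, 1/2]\<close>
  comes from dominance: if \<open>D\<close> is the diagonal of the off-diagonal norms, then
  \<open>0 \<le> L \<le> 2 D\<close> and \<open>X \<ge> \<alpha> D \<ge> 4 D\<close>. On this
  interval \<open>p(t) \<ge> 1 - t \<ge> 1/2\<close>, which yields both the invertibility of
  \<open>Z\<close> and the factor 2 in the error bound; \<open>3 / \<epsilon> < 2 ^ k\<close> leaves
  room for that factor. Dominance alone makes \<open>B\<close> only semidefinite, since
  \<open>X\<close> can be singular in a row without off-diagonal blocks; invertibility of
  \<open>X\<close> makes it definite.\<close>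

definition poly_op :: "('a::real_vector \<Rightarrow> 'a) \<Rightarrow> real poly \<Rightarrow> 'a \<Rightarrow> 'a" where
  "poly_op T p x = fold_coeffs (\<lambda>a v. a *\<^sub>R x + T v) p 0"

lemma poly_op_0 [simp]: "poly_op T 0 x = 0"
  by (simp add: poly_op_def)

lemma poly_op_pCons [simp]:
  assumes "linear T"
  shows "poly_op T (pCons a p) x = a *\<^sub>R x + T (poly_op T p x)"
  unfolding poly_op_def
  by (cases "p = 0 \<and> a = 0") (auto simp: linear_0[OF assms])

lemma poly_op_1 [simp]: "linear T \<Longrightarrow> poly_op T 1 x = x"
  by (simp add: one_pCons linear_0)

lemma poly_op_add: "linear T \<Longrightarrow> poly_op T (p + q) x = poly_op T p x + poly_op T q x"
proof (induction p arbitrary: q)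
  case (pCons a p)
  show ?case
  proof (cases q)
    case (pCons b r)
    then show ?thesis
      using pCons.IH[of r] \<open>linear T\<close> by (simp add: linear_add algebra_simps)
  qed
qed simp

lemma poly_op_smult: "linear T \<Longrightarrow> poly_op T (smult c p) x = c *\<^sub>R poly_op T p x"
  by (induction p) (simp_all add: linear_scale scaleR_add_right)

lemma poly_op_diff: "linear T \<Longrightarrow> poly_op T (p - q) x = poly_op T p x - poly_op T q x"
proof -
  assume "linear T"
  have "p - q = p + smult (- 1) q" by simp
  then show ?thesis
    by (simp only: poly_op_add[OF \<open>linear T\<close>] poly_op_smult[OF \<open>linear T\<close>]) simp
qed

lemma poly_op_mult: "linear T \<Longrightarrow> poly_op T (p * q) x = poly_op T p (poly_op T q x)"
  by (induction p) (simp_all add: poly_op_add poly_op_smult linear_0)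

text \<open>Positivity of \<open>p(T)\<close> is obtained from a certificate of nonnegativity of \<open>p\<close> on \<open>[0, 1/2]\<close> as a
  combination of products of \<open>x\<close> and \<open>1/2 - x\<close>; this replaces the spectral theorem.\<close>

inductive bernstein_cone :: "real poly \<Rightarrow> bool" where
  left: "bernstein_cone [:0, 1:]"
| right: "bernstein_cone [:1/2, -1:]"
| const: "c \<ge> 0 \<Longrightarrow> bernstein_cone [:c:]"
| add: "bernstein_cone p \<Longrightarrow> bernstein_cone q \<Longrightarrow> bernstein_cone (p + q)"
| mult: "bernstein_cone p \<Longrightarrow> bernstein_cone q \<Longrightarrow> bernstein_cone (p * q)"

lemma bernstein_cone_power: "bernstein_cone p \<Longrightarrow> bernstein_cone (p ^ n)"
proof (induction n)
  case 0
  then show ?case using bernstein_cone.const[of 1] by (simp add: one_pCons)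
next
  case (Suc n)
  then show ?case by (simp add: bernstein_cone.mult)
qed

lemma bernstein_cone_smult: "c \<ge> 0 \<Longrightarrow> bernstein_cone p \<Longrightarrow> bernstein_cone (smult c p)"
  using bernstein_cone.mult[OF bernstein_cone.const, of c p] by simp

text \<open>Spectrum in \<open>[0, 1/2]\<close> is expressed by quadratic forms, so no eigenvectors
  occur. The last two assumptions together already force \<open>B\<close> to be positive
  semidefinite.\<close>

locale half_contraction =
  fixes T :: "'a::real_vector \<Rightarrow> 'a" and B :: "'a \<Rightarrow> 'a \<Rightarrow> real"
  assumes linear_T: "linear T"
    and bilinear_B: "bilinear B"
    and B_sym: "B x y = B y x"
    and T_adjoint: "B (T x) y = B x (T y)"
    and T_nonneg: "0 \<le> B (T x) x"
    and T_le_half: "B (T x) x \<le> B x x / 2"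
begin

lemmas poly_op_T = poly_op_add[OF linear_T] poly_op_diff[OF linear_T] poly_op_smult[OF linear_T]
  poly_op_mult[OF linear_T] poly_op_pCons[OF linear_T] linear_0[OF linear_T]

lemmas B_simps = bilinear_ladd[OF bilinear_B] bilinear_radd[OF bilinear_B]
  bilinear_lmul[OF bilinear_B] bilinear_rmul[OF bilinear_B]
  bilinear_lsub[OF bilinear_B] bilinear_rsub[OF bilinear_B]
  bilinear_lzero[OF bilinear_B] bilinear_rzero[OF bilinear_B]

lemma poly_op_commute: "poly_op T p (T x) = T (poly_op T p x)"
  by (induction p) (simp_all add: poly_op_T linear_add[OF linear_T] linear_scale[OF linear_T])

lemma poly_op_adjoint: "B (poly_op T p x) y = B x (poly_op T p y)"
  by (induction p arbitrary: x y) (simp_all add: poly_op_T B_simps T_adjoint poly_op_commute)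

lemma B_nonneg: "0 \<le> B x x"
  using T_nonneg[of x] T_le_half[of x] by simp

section \<open>Quadratic forms of polynomials in \<open>T\<close>\<close>

definition Q :: "real poly \<Rightarrow> 'a \<Rightarrow> real" where
  "Q p x = B (poly_op T p x) x"

lemma Q_add: "Q (p + q) x = Q p x + Q q x"
  by (simp add: Q_def poly_op_T B_simps)

lemma Q_smult: "Q (smult c p) x = c * Q p x"
  by (simp add: Q_def poly_op_T B_simps)

text \<open>By self-adjointness one factor \<open>r(T)\<close> moves to the other argument, so
  multiplying by a square only changes the test vector.\<close>

lemma Q_square: "Q (r * p * r) x = Q p (poly_op T r x)"
  by (simp add: Q_def poly_op_T poly_op_adjoint)

text \<open>\<open>Q_square\<close> absorbs the even part of both exponents and leaves exponents 0
  or 1. Three of these four cases are the locale assumptions and \<open>B_nonneg\<close>; the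
  fourth, \<open>x (1/2 - x)\<close>, is a sum of two terms of the shape \<open>r * p * r\<close>
  again.\<close>

lemma Q_monomial_nonneg: "0 \<le> Q ([:0, 1:] ^ a * [:1/2, -1:] ^ b) x"
proof -
  let ?X = "[:0, 1:] :: real poly" and ?S = "[:1/2, -1:] :: real poly"
  have X: "0 \<le> Q ?X y" and S: "0 \<le> Q ?S y" for y
    using T_nonneg[of y] T_le_half[of y] by (simp_all add: Q_def poly_op_T B_simps linear_neg[OF linear_T])
  \<comment> \<open>multiply by \<open>1 = 2 ((1/2 - x) + x)\<close>\<close>
  have XS_eq: "?X * ?S = smult 2 (?S * ?X * ?S + ?X * ?S * ?X)"
    by simp
  have XS: "0 \<le> Q (?X * ?S) y" for y
    using X S by (subst XS_eq) (simp only: Q_smult Q_add Q_square, simp)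
  have "0 \<le> Q (?X ^ e * ?S ^ f) y" if "e < 2" "f < 2" for e f y
  proof -
    from that have "e = 0 \<or> e = 1" "f = 0 \<or> f = 1" by auto
    then show ?thesis
      using X[of y] S[of y] XS[of y] B_nonneg[of y] by (auto simp: Q_def linear_T)
  qed
  then have base: "0 \<le> Q (?X ^ (a mod 2) * ?S ^ (b mod 2)) y" for y
    by simp
  define r where "r = ?X ^ (a div 2) * ?S ^ (b div 2)"
  have "n = n div 2 + n mod 2 + n div 2" for n :: nat
    by presburger
  then have pow: "p ^ n = p ^ (n div 2) * p ^ (n mod 2) * p ^ (n div 2)" for p :: "real poly" and n
    by (metis power_add)
  have "?X ^ a * ?S ^ b = r * (?X ^ (a mod 2) * ?S ^ (b mod 2)) * r"
    unfolding r_def by (subst pow[of _ a], subst pow[of _ b]) (simp only: mult_ac)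
  then show ?thesis
    using base by (simp only: Q_square)
qed

text \<open>Nonnegativity of \<open>p(T)\<close> and \<open>q(T)\<close> separately says nothing
  about their product under induction. The property \<open>pos\<close> therefore quantifies over all
  monomial multipliers, and the induction shows that multiplication by \<open>p\<close> preserves
  \<open>pos\<close>; the product case is then composition.\<close>

lemma bernstein_cone_nonneg:
  assumes "bernstein_cone p"
  shows "0 \<le> B (poly_op T p x) x"
proof -
  let ?X = "[:0, 1:] :: real poly" and ?S = "[:1/2, -1:] :: real poly"
  define pos where "pos q \<longleftrightarrow> (\<forall>a b x. 0 \<le> Q (?X ^ a * ?S ^ b * q) x)" for q
  have "pos q \<longrightarrow> pos (p * q)" for q
    using assms
  proof (induction p arbitrary: q)
    case left
    show ?case
      unfolding pos_def
    proof (intro impI allI)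
      fix a b x assume *: "\<forall>a b x. 0 \<le> Q (?X ^ a * ?S ^ b * q) x"
      have "?X ^ a * ?S ^ b * (?X * q) = ?X ^ Suc a * ?S ^ b * q"
        by (simp only: power_Suc mult_ac)
      then show "0 \<le> Q (?X ^ a * ?S ^ b * (?X * q)) x" by (simp only: *)
    qed
  next
    case right
    show ?case
      unfolding pos_def
    proof (intro impI allI)
      fix a b x assume *: "\<forall>a b x. 0 \<le> Q (?X ^ a * ?S ^ b * q) x"
      have "?X ^ a * ?S ^ b * (?S * q) = ?X ^ a * ?S ^ Suc b * q"
        by (simp only: power_Suc mult_ac)
      then show "0 \<le> Q (?X ^ a * ?S ^ b * (?S * q)) x" by (simp only: *)
    qed
  next
    case (const c)
    then show ?case by (simp add: pos_def Q_smult)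
  next
    case (add p1 p2)
    then show ?case by (simp add: pos_def distrib_left distrib_right Q_add)
  next
    case (mult p1 p2)
    then show ?case by (simp add: mult.assoc)
  qed
  moreover have "pos 1"
    using Q_monomial_nonneg by (simp add: pos_def)
  ultimately have "pos (p * 1)" by blast
  then have "0 \<le> Q (?X ^ 0 * ?S ^ 0 * (p * 1)) x" unfolding pos_def by blast
  then show ?thesis by (simp add: Q_def)
qed

end

section \<open>The Jacobi polynomials\<close>

text \<open>The partial sums of the alternating geometric series for \<open>1 / (1 + x)\<close>, in
  the recursive form that mirrors one sweep.\<close>

primrec jacobi_poly :: "nat \<Rightarrow> real poly" where
  "jacobi_poly 0 = 1"
| "jacobi_poly (Suc t) = 1 - [:0, 1:] * jacobi_poly t"

lemma jacobi_poly_telescope: "[:1, 1:] * jacobi_poly t = 1 - (- [:0, 1:]) ^ Suc t"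
proof (induction t)
  case 0
  then show ?case by (simp add: one_pCons)
next
  case (Suc t)
  have "[:1, 1:] * jacobi_poly (Suc t) = [:1, 1:] - [:0, 1:] * ([:1, 1:] * jacobi_poly t)"
    by (simp add: algebra_simps)
  also have "\<dots> = [:1, 1:] - [:0, 1:] * (1 - (- [:0, 1:]) ^ Suc t)"
    by (simp only: Suc.IH)
  also have "\<dots> = ([:1, 1:] - [:0, 1:]) + [:0, 1:] * (- [:0, 1:]) ^ Suc t"
    by (simp add: algebra_simps)
  also have "\<dots> = 1 - (- [:0, 1:]) ^ Suc (Suc t)"
    by (simp add: one_pCons)
  finally show ?case .
qed

text \<open>Two steps of the recursion give \<open>p_(k+2) = (1 - x) + x^2 p_k\<close>, and
  \<open>1 - x = (1/2 - x) + 1/2\<close> is in the cone.\<close>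

lemma jacobi_poly_ge:
  assumes "odd k"
  shows "bernstein_cone (jacobi_poly k - [:1, -1:])"
proof -
  have "bernstein_cone (jacobi_poly (Suc (2 * m)) - [:1, -1:])" for m
  proof (induction m)
    case 0
    then show ?case using bernstein_cone.const[of 0] by (simp add: one_pCons)
  next
    case (Suc m)
    have "jacobi_poly (Suc (2 * Suc m)) - [:1, -1:]
        = [:0, 1:] ^ 2 * ((jacobi_poly (Suc (2 * m)) - [:1, -1:]) + ([:1/2, -1:] + [:1/2:]))"
      by (simp add: one_pCons power2_eq_square algebra_simps)
    moreover have "bernstein_cone \<dots>"
      by (intro bernstein_cone.intros bernstein_cone_power Suc.IH) simp
    ultimately show ?case by simp
  qed
  then show ?thesis using assms by (auto elim!: oddE)
qed

lemma half_power_ge: "bernstein_cone ([:(1/2) ^ k:] - [:0, 1:] ^ k)"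
proof (induction k)
  case 0
  then show ?case using bernstein_cone.const[of 0] by (simp add: one_pCons)
next
  case (Suc k)
  have "[:(1/2) ^ Suc k:] - [:0, 1:] ^ Suc k
      = ( [:1/2:] * ([:(1/2) ^ k:] - [:0, 1:] ^ k) + [:0, 1:] ^ k * [:1/2, -1:] :: real poly)"
    by (simp add: smult_diff_right)
  moreover have "bernstein_cone \<dots>"
    by (intro bernstein_cone.intros bernstein_cone_power Suc.IH) simp
  ultimately show ?case by simp
qed

text \<open>Since \<open>p \<ge> 1 - x \<ge> 1/2\<close> on the interval, the factor 2 gives
  \<open>2 (1/2)^k p \<ge> (1/2)^k \<ge> x^k\<close>. The three summands in the proof are the slacks
  of these three inequalities.\<close>

lemma jacobi_poly_ge_power:
  assumes "odd k"
  shows "bernstein_cone (smult (2 * (1/2) ^ k) (jacobi_poly k) - [:0, 1:] ^ k)"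
proof -
  let ?c = "(1/2::real) ^ k"
  have "smult (2 * ?c) (jacobi_poly k) - [:0, 1:] ^ k
     = smult (2 * ?c) (jacobi_poly k - [:1, -1:]) + smult (2 * ?c) [:1/2, -1:]
       + ([:?c:] - [:0, 1:] ^ k)"
    by (simp add: smult_diff_right)
  moreover have "bernstein_cone \<dots>"
    by (intro bernstein_cone.intros bernstein_cone_smult jacobi_poly_ge half_power_ge assms) simp_all
  ultimately show ?thesis by (simp only:)
qed

section \<open>Polynomial bounds transferred to the operator\<close>

context half_contraction
begin

text \<open>The coercivity that later makes the computed operator injective.\<close>

lemma jacobi_poly_lower:
  assumes "odd k"
  shows "B x x / 2 \<le> B (poly_op T (jacobi_poly k) x) x"
proof -
  have "bernstein_cone (jacobi_poly k - [:1, -1:] + [:1/2, -1:])"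
    by (intro bernstein_cone.intros jacobi_poly_ge assms)
  from bernstein_cone_nonneg[OF this, of x] show ?thesis
    by (simp add: poly_op_T B_simps linear_0)
qed

text \<open>Moving \<open>p(T)\<close> across the form reduces the claim to
  \<open>p(x) x^(k+1)\<close> being in the cone. For \<open>x\<close> the vector
  \<open>X\<inverse> b\<close>, the expression is the error form at \<open>Z b\<close>.\<close>

lemma jacobi_gap_nonneg:
  assumes "odd k"
  shows "0 \<le> B (poly_op T (jacobi_poly k) x) (poly_op T ([:0, 1:] ^ Suc k) x)"
proof -
  have "jacobi_poly k * [:0, 1:] ^ Suc k
      = (jacobi_poly k - [:1, -1:] + ([:1/2, -1:] + [:1/2:])) * [:0, 1:] ^ Suc k"
    by simp
  moreover have "bernstein_cone \<dots>"
    by (intro bernstein_cone.intros bernstein_cone_power jacobi_poly_ge assms) simp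
  ultimately have "bernstein_cone (jacobi_poly k * [:0, 1:] ^ Suc k)" by simp
  from bernstein_cone_nonneg[OF this, of x]
  have "0 \<le> B x (poly_op T (jacobi_poly k * [:0, 1:] ^ Suc k) x)"
    by (subst B_sym)
  then show ?thesis
    by (simp only: poly_op_mult[OF linear_T, of "jacobi_poly k"] poly_op_adjoint)
qed

text \<open>The certificate is \<open>p * x * (2 (1/2)^k p - x^k)\<close>: the separate factor
  \<open>x\<close> is the power of \<open>T\<close> that is kept for the form of
  \<open>L\<close>.\<close>

lemma jacobi_gap_le:
  fixes x :: 'a
  assumes "odd k"
  defines "v \<equiv> poly_op T (jacobi_poly k) x"
  shows "B v (poly_op T ([:0, 1:] ^ Suc k) x) \<le> 2 * (1/2) ^ k * B v (T v)"
proof -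
  let ?p = "jacobi_poly k" and ?X = "[:0, 1:] :: real poly"
  let ?D = "smult (2 * (1/2) ^ k) ?p - ?X ^ k"
  have "bernstein_cone (?p - [:1, -1:] + ([:1/2, -1:] + [:1/2:]))"
    by (intro bernstein_cone.intros jacobi_poly_ge assms) simp
  then have "bernstein_cone ?p" by simp
  then have "bernstein_cone (?p * (?X * ?D))"
    by (intro bernstein_cone.mult bernstein_cone.left jacobi_poly_ge_power assms)
  from bernstein_cone_nonneg[OF this, of x]
  have "0 \<le> B (poly_op T (?X * ?D) x) v"
    unfolding v_def by (simp only: poly_op_mult[OF linear_T, of ?p "?X * ?D"] poly_op_adjoint)
  then have "0 \<le> B v (poly_op T (?X * ?D) x)"
    by (subst B_sym)
  moreover have "?X * ?D = smult (2 * (1/2) ^ k) (?X * ?p) - ?X ^ Suc k"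
    by (simp add: algebra_simps)
  ultimately show ?thesis
    by (simp only: poly_op_diff[OF linear_T] poly_op_smult[OF linear_T] B_simps
        poly_op_mult[OF linear_T, of ?X ?p] v_def poly_op_pCons[OF linear_T] poly_op_0
        linear_0[OF linear_T]) simp
qed

end

section \<open>Block vectors as a real vector space\<close>

text \<open>Makes linear maps, bilinear forms and spans available for block vectors. These live on
  all indices; finite dimension enters only through restricting the support to a finite set.\<close>

instantiation "fun" :: (type, real_vector) real_vector
begin

definition scaleR_fun :: "real \<Rightarrow> ('a \<Rightarrow> 'b) \<Rightarrow> 'a \<Rightarrow> 'b" where
  "scaleR_fun c f = (\<lambda>x. c *\<^sub>R f x)"

instance
  by standard (simp_all add: scaleR_fun_def plus_fun_def algebra_simps)

end

lemma scaleR_fun_apply [simp]: "(c *\<^sub>R f) x = c *\<^sub>R f x"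
  by (simp add: scaleR_fun_def)

lemma sum_fun_apply: "(\<Sum>x\<in>A. f x) y = (\<Sum>x\<in>A. f x y)"
  by (induction A rule: infinite_finite_induct) simp_all

text \<open>Working with the real part of the Hermitian inner product loses nothing: a complex matrix is
  Hermitian iff it is symmetric for the real inner product.\<close>

lemma Re_cinner: "Re (cinner x y) = x \<bullet> y"
  by (simp add: cinner_def inner_vec_def inner_complex_def)

lemma cinner_conj_transpose: "cinner x (A *v y) = cinner (conj_transpose A *v x) y"
proof -
  have "cinner x (A *v y) = (\<Sum>l\<in>UNIV. \<Sum>m\<in>UNIV. cnj (x $ l) * (A $ l $ m * y $ m))"
    by (simp add: cinner_def matrix_vector_mult_def sum_distrib_left)
  also have "\<dots> = (\<Sum>m\<in>UNIV. \<Sum>l\<in>UNIV. cnj (x $ l) * (A $ l $ m * y $ m))"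
    by (rule sum.swap)
  also have "\<dots> = cinner (conj_transpose A *v x) y"
    by (simp add: cinner_def matrix_vector_mult_def conj_transpose_def sum_distrib_left sum_distrib_right mult_ac)
  finally show ?thesis .
qed

lemma inner_conj_transpose: "x \<bullet> (A *v y) = (conj_transpose A *v x) \<bullet> y"
  using arg_cong[OF cinner_conj_transpose, of Re] by (simp add: Re_cinner)

lemma conj_transpose_conj_transpose [simp]: "conj_transpose (conj_transpose A) = A"
  by (simp add: conj_transpose_def vec_eq_iff)

lemma conj_transpose_0 [simp]: "conj_transpose 0 = 0"
  by (simp add: conj_transpose_def vec_eq_iff)

lemma conj_transpose_diff: "conj_transpose (A - B) = conj_transpose A - conj_transpose B"
  by (simp add: conj_transpose_def vec_eq_iff)

lemma conj_transpose_scaled_one: "conj_transpose (c *\<^sub>R mat 1) = c *\<^sub>R mat 1"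
  by (simp add: conj_transpose_def mat_def vec_eq_iff)

lemma linear_mult_vec: "linear ((*v) (A :: 'r::finite block))"
  by (rule bounded_linear.linear) simp

lemmas block_vec_simps =
  linear_add[OF linear_mult_vec] linear_diff[OF linear_mult_vec] linear_neg[OF linear_mult_vec]
  linear_scale[OF linear_mult_vec] linear_0[OF linear_mult_vec] linear_sum[OF linear_mult_vec]
  matrix_vector_mult_add_rdistrib matrix_vector_mult_diff_rdistrib

lemma scaleR_mult_vec: "(c *\<^sub>R A) *v x = c *\<^sub>R (A *v x)" for A :: "'r::finite block"
  by (simp add: matrix_vector_mult_def vec_eq_iff scaleR_sum_right)

lemma sum_mult_vec: "(\<Sum>j\<in>J. A j) *v x = (\<Sum>j\<in>J. A j *v x)" for A :: "_ \<Rightarrow> 'r::finite block"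
  by (induction J rule: infinite_finite_induct) (simp_all add: block_vec_simps)

lemma mult_vec_axis: "A *v axis l 1 = (\<chi> a. A $ a $ l)" for A :: "'r::finite block"
  by (simp add: matrix_vector_mult_def axis_def if_distrib cong: if_cong)

lemma uminus_mult_vec: "(- A) *v x = - (A *v x)" for A :: "'r::finite block"
  using scaleR_mult_vec[of "- 1" A x] by simp

section \<open>The operator norm of a block\<close>

lemma norm_mult_vec_le: "norm (A *v x) \<le> opnorm A * norm x" for A :: "'r::finite block"
  unfolding opnorm_def by (rule onorm) simp

lemma opnorm_nonneg: "0 \<le> opnorm A" for A :: "'r::finite block"
  unfolding opnorm_def by (rule onorm_pos_le) simp

lemma opnorm_0 [simp]: "opnorm (0 :: 'r::finite block) = 0"
  by (simp add: opnorm_def onorm_zero)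

text \<open>For \<open>y = conj_transpose A *v x\<close>, Cauchy-Schwarz bounds
  \<open>norm y ^ 2 = x \<bullet> (A *v y)\<close>, and one factor \<open>norm y\<close> cancels.
  This makes the norms of a Hermitian block matrix symmetric in the two indices.\<close>

lemma opnorm_conj_transpose [simp]: "opnorm (conj_transpose A) = opnorm A" for A :: "'r::finite block"
proof -
  have "opnorm (conj_transpose A) \<le> opnorm A" for A :: "'r block"
    unfolding opnorm_def[of "conj_transpose A"]
  proof (rule onorm_le)
    fix x :: "complex^'r"
    let ?y = "conj_transpose A *v x"
    have "norm ?y * norm ?y = x \<bullet> (A *v ?y)"
      by (simp add: inner_conj_transpose flip: power2_norm_eq_inner power2_eq_square)
    also have "\<dots> \<le> norm x * norm (A *v ?y)"
      by (rule norm_cauchy_schwarz)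
    also have "\<dots> \<le> norm x * (opnorm A * norm ?y)"
      by (intro mult_left_mono norm_mult_vec_le) simp
    finally have "norm ?y * norm ?y \<le> (opnorm A * norm x) * norm ?y"
      by (simp add: mult_ac)
    then show "norm ?y \<le> opnorm A * norm x"
      using opnorm_nonneg[of A] by (cases "?y = 0") (auto simp: mult_le_cancel_right)
  qed
  from this[of A] this[of "conj_transpose A"] show ?thesis by simp
qed

lemma psd_block_inner: "psd_block A \<Longrightarrow> 0 \<le> x \<bullet> (A *v x)"
  by (simp add: psd_block_def Re_cinner)

section \<open>Block matrices as operators\<close>

definition bvec_inner :: "nat set \<Rightarrow> 'r::finite bvec \<Rightarrow> 'r bvec \<Rightarrow> real" where
  "bvec_inner S x y = (\<Sum>i\<in>S. x i \<bullet> y i)"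

lemma bvec_inner_commute: "bvec_inner S x y = bvec_inner S y x"
  by (simp add: bvec_inner_def inner_commute)

lemma bvec_inner_cong:
  "(\<And>i. i \<in> S \<Longrightarrow> x i = x' i) \<Longrightarrow> (\<And>i. i \<in> S \<Longrightarrow> y i = y' i) \<Longrightarrow> bvec_inner S x y = bvec_inner S x' y'"
  by (simp add: bvec_inner_def)

lemma bilinear_bvec_inner: "bilinear (bvec_inner S)"
  unfolding bilinear_def
  by (auto intro!: linearI simp: bvec_inner_def inner_add_left inner_add_right sum.distrib sum_distrib_left)

lemma bvec_inner_diff_right: "bvec_inner S x (y - z) = bvec_inner S x y - bvec_inner S x z"
  by (rule bilinear_rsub[OF bilinear_bvec_inner])

lemma linear_bmat_vec: "linear (bmat_vec S A)"
  by (rule linearI) (auto simp: bmat_vec_def fun_eq_iff block_vec_simps sum.distrib scaleR_sum_right)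

lemma bmat_vec_cong: "(\<And>j. j \<in> S \<Longrightarrow> x j = y j) \<Longrightarrow> bmat_vec S A x = bmat_vec S A y"
  by (simp add: bmat_vec_def)

lemma bmat_vec_diff_mat: "bmat_vec S (\<lambda>i j. A i j - B i j) x = bmat_vec S A x - bmat_vec S B x"
  by (simp add: bmat_vec_def fun_eq_iff block_vec_simps sum_subtractf)

lemma bmat_vec_scale_mat: "bmat_vec S (\<lambda>i j. c *\<^sub>R A i j) x = c *\<^sub>R bmat_vec S A x"
  by (simp add: bmat_vec_def fun_eq_iff scaleR_mult_vec scaleR_sum_right)

lemma bmat_vec_outside: "A \<in> bmats S T \<Longrightarrow> i \<notin> S \<Longrightarrow> bmat_vec T A x i = 0"
  by (simp add: bmat_vec_def bmats_def)

lemma bmat_vec_mult: "bmat_vec T (bmat_mult S A B) x = bmat_vec S A (bmat_vec T B x)"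
proof
  fix i
  have "bmat_vec T (bmat_mult S A B) x i = (\<Sum>k\<in>T. \<Sum>j\<in>S. A i j *v (B j k *v x k))"
    by (simp add: bmat_vec_def bmat_mult_def sum_mult_vec matrix_vector_mul_assoc)
  also have "\<dots> = bmat_vec S A (bmat_vec T B x) i"
    by (simp add: bmat_vec_def block_vec_simps sum.swap[of _ S T])
  finally show "bmat_vec T (bmat_mult S A B) x i = bmat_vec S A (bmat_vec T B x) i" .
qed

lemma bmat_vec_id: "finite S \<Longrightarrow> bmat_vec S (bmat_id S) x = (\<lambda>i. if i \<in> S then x i else 0)"
proof
  fix i assume S: "finite S"
  have "bmat_vec S (bmat_id S) x i = (\<Sum>j\<in>S. if j = i then x i else 0)"
    unfolding bmat_vec_def bmat_id_def by (intro sum.cong) auto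
  then show "bmat_vec S (bmat_id S) x i = (if i \<in> S then x i else 0)"
    using S by simp
qed

section \<open>Testing a block matrix on vectors with a single block\<close>

definition single_bvec :: "nat \<Rightarrow> complex^'r::finite \<Rightarrow> 'r bvec" where
  "single_bvec i u = (\<lambda>j. if j = i then u else 0)"

lemma bmat_vec_single:
  assumes "finite S" "j \<in> S"
  shows "bmat_vec S A (single_bvec j v) i = A i j *v v"
proof -
  have "bmat_vec S A (single_bvec j v) i = (\<Sum>k\<in>S. if k = j then A i j *v v else 0)"
    unfolding bmat_vec_def single_bvec_def by (intro sum.cong) (auto simp: block_vec_simps)
  then show ?thesis using assms by simp
qed

lemma bvec_inner_single:
  assumes "finite S" "i \<in> S"
  shows "bvec_inner S (single_bvec i u) y = u \<bullet> y i"
proof -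
  have "bvec_inner S (single_bvec i u) y = (\<Sum>k\<in>S. if k = i then u \<bullet> y i else 0)"
    unfolding bvec_inner_def single_bvec_def by (intro sum.cong) auto
  then show ?thesis using assms by simp
qed

lemma bmat_eqI:
  assumes "finite S" "A \<in> bmats S S" "B \<in> bmats S S" "\<And>x. bmat_vec S A x = bmat_vec S B x"
  shows "A = B"
proof -
  have "A i j = B i j" for i j
  proof (cases "j \<in> S")
    case True
    have "A i j *v v = B i j *v v" for v
    proof -
      have "bmat_vec S A (single_bvec j v) i = bmat_vec S B (single_bvec j v) i"
        by (simp only: assms(4))
      then show ?thesis by (simp only: bmat_vec_single[OF assms(1) True])
    qed
    then show ?thesis by (simp only: matrix_eq) blast
  next
    case False
    then show ?thesis using assms(2,3) by (simp add: bmats_def)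
  qed
  then show ?thesis by blast
qed

text \<open>Allows the Hermitian property of an inverse or a Schur complement to be read off from
  its form, without computing blocks.\<close>

lemma hermitian_iff:
  assumes "finite S"
  shows "hermitian S A \<longleftrightarrow>
    (\<forall>x y. bvec_inner S x (bmat_vec S A y) = bvec_inner S (bmat_vec S A x) y)"
proof
  assume herm: "hermitian S A"
  show "\<forall>x y. bvec_inner S x (bmat_vec S A y) = bvec_inner S (bmat_vec S A x) y"
  proof (intro allI)
    fix x y
    have "bvec_inner S x (bmat_vec S A y) = (\<Sum>i\<in>S. \<Sum>j\<in>S. x i \<bullet> (A i j *v y j))"
      by (simp add: bvec_inner_def bmat_vec_def inner_sum_right)
    also have "\<dots> = (\<Sum>i\<in>S. \<Sum>j\<in>S. (A j i *v x i) \<bullet> y j)"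
    proof (intro sum.cong refl)
      fix i j assume "i \<in> S" "j \<in> S"
      then have "A j i = conj_transpose (A i j)" using herm unfolding hermitian_def by blast
      then show "x i \<bullet> (A i j *v y j) = (A j i *v x i) \<bullet> y j"
        by (simp add: inner_conj_transpose)
    qed
    also have "\<dots> = bvec_inner S (bmat_vec S A x) y"
      by (subst sum.swap) (simp add: bvec_inner_def bmat_vec_def inner_sum_left)
    finally show "bvec_inner S x (bmat_vec S A y) = bvec_inner S (bmat_vec S A x) y" .
  qed
next
  assume sym: "\<forall>x y. bvec_inner S x (bmat_vec S A y) = bvec_inner S (bmat_vec S A x) y"
  show "hermitian S A"
    unfolding hermitian_def
  proof (intro ballI)
    fix i j assume ij: "i \<in> S" "j \<in> S"
    have "A i j *v v = conj_transpose (A j i) *v v" for v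
    proof (rule vector_eq_rdot[THEN iffD1], rule allI)
      fix u
      have "u \<bullet> (A i j *v v) = bvec_inner S (single_bvec i u) (bmat_vec S A (single_bvec j v))"
        by (simp only: bvec_inner_single[OF assms ij(1)] bmat_vec_single[OF assms ij(2)])
      also have "\<dots> = bvec_inner S (bmat_vec S A (single_bvec i u)) (single_bvec j v)"
        using sym by blast
      also have "\<dots> = bvec_inner S (single_bvec j v) (bmat_vec S A (single_bvec i u))"
        by (rule bvec_inner_commute)
      also have "\<dots> = v \<bullet> (A j i *v u)"
        by (simp only: bvec_inner_single[OF assms ij(2)] bmat_vec_single[OF assms ij(1)])
      also have "\<dots> = (conj_transpose (A j i) *v v) \<bullet> u"
        by (rule inner_conj_transpose)
      finally show "(A i j *v v) \<bullet> u = (conj_transpose (A j i) *v v) \<bullet> u"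
        by (simp only: inner_commute)
    qed
    then show "A i j = conj_transpose (A j i)" unfolding matrix_eq by blast
  qed
qed

section \<open>Quadratic forms and diagonal dominance\<close>

lemma psd_iff:
  "psd S A \<longleftrightarrow> hermitian S A \<and> (\<forall>x. 0 \<le> bvec_inner S x (bmat_vec S A x))"
  by (simp add: psd_def Re_cinner bvec_inner_def bmat_vec_def inner_sum_right)

text \<open>A block Gershgorin bound: each term is split by \<open>2 a b \<le> a^2 + b^2\<close>,
  and exchanging the two indices turns the second half of the sum into the first, because the norms
  are symmetric.\<close>

lemma offdiag_form_le:
  assumes "finite S" "hermitian S A"
  shows "\<bar>\<Sum>i\<in>S. \<Sum>j\<in>S - {i}. x i \<bullet> (A i j *v x j)\<bar> \<le> (\<Sum>i\<in>S. offdiag_norm S A i * (norm (x i))\<^sup>2)"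
proof -
  let ?P = "SIGMA i:S. S - {i}"
  have pairs: "(\<Sum>i\<in>S. \<Sum>j\<in>S - {i}. f i j) = (\<Sum>(i, j)\<in>?P. f i j)" for f :: "nat \<Rightarrow> nat \<Rightarrow> real"
    using assms(1) by (intro sum.Sigma) auto
  have swap: "(\<Sum>(i, j)\<in>?P. f i j) = (\<Sum>(i, j)\<in>?P. f j i)" for f :: "nat \<Rightarrow> nat \<Rightarrow> real"
    by (rule sum.reindex_bij_witness[where i = prod.swap and j = prod.swap]) auto
  let ?n = "\<lambda>i j. opnorm (A i j)"
  have bound: "\<bar>x i \<bullet> (A i j *v x j)\<bar> \<le> ?n i j * (norm (x i))\<^sup>2 / 2 + ?n j i * (norm (x j))\<^sup>2 / 2"
    if "i \<in> S" "j \<in> S" for i j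
  proof -
    have "A j i = conj_transpose (A i j)" using assms(2) that unfolding hermitian_def by blast
    then have [simp]: "?n j i = ?n i j" by simp
    have "\<bar>x i \<bullet> (A i j *v x j)\<bar> \<le> norm (x i) * norm (A i j *v x j)"
      by (rule Cauchy_Schwarz_ineq2)
    also have "\<dots> \<le> norm (x i) * (?n i j * norm (x j))"
      by (intro mult_left_mono norm_mult_vec_le) simp
    also have "\<dots> = ?n i j * (norm (x i) * norm (x j))" by simp
    also have "\<dots> \<le> ?n i j * (((norm (x i))\<^sup>2 + (norm (x j))\<^sup>2) / 2)"
      using sum_squares_bound[of "norm (x i)" "norm (x j)"]
      by (intro mult_left_mono opnorm_nonneg) simp
    finally show ?thesis by (simp add: algebra_simps add_divide_distrib)
  qed
  have "\<bar>\<Sum>i\<in>S. \<Sum>j\<in>S - {i}. x i \<bullet> (A i j *v x j)\<bar>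
      \<le> (\<Sum>(i, j)\<in>?P. \<bar>x i \<bullet> (A i j *v x j)\<bar>)"
    unfolding pairs by (rule order_trans[OF sum_abs]) (simp add: case_prod_beta)
  also have "\<dots> \<le> (\<Sum>(i, j)\<in>?P. ?n i j * (norm (x i))\<^sup>2 / 2 + ?n j i * (norm (x j))\<^sup>2 / 2)"
    using bound by (intro sum_mono) auto
  also have "\<dots> = (\<Sum>(i, j)\<in>?P. ?n i j * (norm (x i))\<^sup>2 / 2) + (\<Sum>(i, j)\<in>?P. ?n j i * (norm (x j))\<^sup>2 / 2)"
    by (simp add: case_prod_beta sum.distrib)
  also have "(\<Sum>(i, j)\<in>?P. ?n j i * (norm (x j))\<^sup>2 / 2) = (\<Sum>(i, j)\<in>?P. ?n i j * (norm (x i))\<^sup>2 / 2)"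
    by (rule swap)
  also have "(\<Sum>(i, j)\<in>?P. ?n i j * (norm (x i))\<^sup>2 / 2) + (\<Sum>(i, j)\<in>?P. ?n i j * (norm (x i))\<^sup>2 / 2)
      = (\<Sum>(i, j)\<in>?P. ?n i j * (norm (x i))\<^sup>2)"
    by (simp add: case_prod_beta flip: sum.distrib)
  also have "\<dots> = (\<Sum>i\<in>S. offdiag_norm S A i * (norm (x i))\<^sup>2)"
    unfolding offdiag_norm_def sum_distrib_right pairs ..
  finally show ?thesis .
qed

lemma bvec_inner_bmat_vec_diag:
  assumes "finite S"
  shows "bvec_inner S x (bmat_vec S A x)
    = (\<Sum>i\<in>S. x i \<bullet> (A i i *v x i)) + (\<Sum>i\<in>S. \<Sum>j\<in>S - {i}. x i \<bullet> (A i j *v x j))"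
  using assms
  by (simp add: bvec_inner_def bmat_vec_def inner_sum_right inner_add_right sum.remove
      flip: sum.distrib)

lemma bDD_form_nonneg:
  assumes "finite S" "bDD S A"
  shows "0 \<le> bvec_inner S x (bmat_vec S A x)"
proof -
  have "(\<Sum>i\<in>S. offdiag_norm S A i * (norm (x i))\<^sup>2) \<le> (\<Sum>i\<in>S. x i \<bullet> (A i i *v x i))"
  proof (rule sum_mono)
    fix i assume "i \<in> S"
    then have "0 \<le> x i \<bullet> ((A i i - offdiag_norm S A i *\<^sub>R mat 1) *v x i)"
      using assms by (intro psd_block_inner) (simp add: bDD_def)
    then show "offdiag_norm S A i * (norm (x i))\<^sup>2 \<le> x i \<bullet> (A i i *v x i)"
      by (simp add: block_vec_simps scaleR_mult_vec inner_diff_right power2_norm_eq_inner)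
  qed
  then show ?thesis
    using offdiag_form_le[of S A x] assms by (simp add: bvec_inner_bmat_vec_diag bDD_def)
qed

section \<open>Inverses\<close>

lemma matrix_inv_mult: "invertible A \<Longrightarrow> matrix_inv A ** A = mat 1"
  unfolding invertible_def matrix_inv_def by (rule someI2_ex) auto

lemma is_bmat_inv_bmat_inv:
  assumes "bmat_invertible S A"
  shows "is_bmat_inv S A (bmat_inv S A)"
  using assms unfolding bmat_invertible_def bmat_inv_def by (rule someI_ex)

lemma is_bmat_inv_vec:
  assumes "finite S" "is_bmat_inv S A B" "i \<in> S"
  shows "bmat_vec S A (bmat_vec S B x) i = x i" "bmat_vec S B (bmat_vec S A x) i = x i"
  using assms by (simp_all add: is_bmat_inv_def bmat_vec_id flip: bmat_vec_mult)

text \<open>An injective operator maps a basis of the finite-dimensional space of block vectors on \<open>S\<close> to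
  an independent set of the same cardinality, which therefore spans.\<close>

lemma bmat_invertible_if_injective:
  fixes Z :: "'r::finite bmat"
  assumes "finite S" "Z \<in> bmats S S"
    and inj: "\<And>x. (\<And>i. i \<notin> S \<Longrightarrow> x i = 0) \<Longrightarrow> bmat_vec S Z x = 0 \<Longrightarrow> x = 0"
  shows "bmat_invertible S Z"
proof -
  define W :: "'r bvec set" where "W = {x. \<forall>i. i \<notin> S \<longrightarrow> x i = 0}"
  \<comment> \<open>A finite real spanning set of \<open>W\<close>, used to bound the size of the
    basis \<open>E\<close>.\<close>
  define G where "G = (\<lambda>(i, v). single_bvec i v) ` (S \<times> (Basis :: (complex^'r) set))"
  have "finite G" using assms by (auto simp: G_def)
  have "W \<subseteq> span G"
  proof
    fix x assume "x \<in> W"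
    have "x = (\<Sum>i\<in>S. \<Sum>v\<in>Basis. (x i \<bullet> v) *\<^sub>R single_bvec i v)"
    proof
      fix j
      have "(\<Sum>i\<in>S. \<Sum>v\<in>Basis. (x i \<bullet> v) *\<^sub>R single_bvec i v) j
          = (\<Sum>i\<in>S. if i = j then \<Sum>v\<in>Basis. (x i \<bullet> v) *\<^sub>R v else 0)"
        unfolding sum_fun_apply by (intro sum.cong) (auto simp: single_bvec_def)
      also have "\<dots> = x j"
        using \<open>x \<in> W\<close> assms(1) by (auto simp: W_def euclidean_representation)
      finally show "x j = (\<Sum>i\<in>S. \<Sum>v\<in>Basis. (x i \<bullet> v) *\<^sub>R single_bvec i v) j" ..
    qed
    also have "\<dots> \<in> span G"
      by (intro span_sum span_scale span_base) (auto simp: G_def)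
    finally show "x \<in> span G" .
  qed
  obtain E where E: "E \<subseteq> W" "independent E" "W \<subseteq> span E"
    using maximal_independent_subset by blast
  have "finite E"
    using E \<open>W \<subseteq> span G\<close> \<open>finite G\<close> by (meson independent_span_bound order_trans)
  have "subspace W"
    by (auto simp: W_def subspace_def)
  then have span_E: "span E = W"
    using E span_minimal by blast
  let ?f = "bmat_vec S Z"
  have lin: "linear ?f" by (rule linear_bmat_vec)
  have inj_on: "inj_on ?f (span E)"
    unfolding span_E linear_inj_on_iff_eq_0[OF lin \<open>subspace W\<close>] using inj unfolding W_def mem_Collect_eq by blast
  then have indep: "independent (?f ` E)"
    by (rule linear_independent_injective_image[OF lin E(2)])
  have card: "card (?f ` E) = card E"
    by (rule card_image) (rule inj_on_subset[OF inj_on span_superset])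
  have sub: "?f ` E \<subseteq> span E"
    unfolding span_E using bmat_vec_outside[OF assms(2)] by (auto simp: W_def)
  have "W \<subseteq> span (?f ` E)"
  proof (rule ccontr)
    assume "\<not> W \<subseteq> span (?f ` E)"
    then obtain y where y: "y \<in> W" "y \<notin> span (?f ` E)" by blast
    then have "independent (insert y (?f ` E))"
      using indep by (intro independent_insertI)
    moreover have "insert y (?f ` E) \<subseteq> span E"
      using y(1) sub by (simp only: span_E insert_subset)
    ultimately have "card (insert y (?f ` E)) \<le> card E"
      by (rule independent_span_bound[OF \<open>finite E\<close>, THEN conjunct2])
    moreover have "y \<notin> ?f ` E" using y(2) by (meson span_base)
    then have "card (insert y (?f ` E)) = Suc (card E)"
      unfolding card[symmetric] by (rule card_insert_disjoint[OF finite_imageI[OF \<open>finite E\<close>]])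
    ultimately show False by linarith
  qed
  then have surj: "\<exists>x. ?f x = y" if "y \<in> W" for y
    using that linear_span_image[OF lin, of E] by auto
  have "\<forall>i l. \<exists>x. ?f x = single_bvec i (axis l 1) \<or> i \<notin> S"
    using surj by (auto simp: W_def single_bvec_def)
  then obtain g where g: "\<And>i l. i \<in> S \<Longrightarrow> ?f (g i l) = single_bvec i (axis l 1)"
    by metis
  \<comment> \<open>Column \<open>l\<close> of block column \<open>j\<close> is the preimage under
    \<open>Z\<close> of the corresponding unit vector.\<close>
  define Y :: "'r bmat" where "Y = (\<lambda>i j. if i \<in> S \<and> j \<in> S then (\<chi> a l. g j l i $ a) else 0)"
  have YB: "Y \<in> bmats S S" by (simp add: Y_def bmats_def)
  have ZY: "bmat_mult S Z Y = bmat_id S"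
  proof (intro ext)
    fix i j
    have "bmat_mult S Z Y i j *v axis l 1 = bmat_id S i j *v axis l 1" for l
    proof (cases "j \<in> S")
      case True
      have col: "Y k j *v axis l 1 = g j l k" if "k \<in> S" for k
        using that True by (simp add: Y_def mult_vec_axis)
      have "bmat_mult S Z Y i j *v axis l 1 = ?f (g j l) i"
        unfolding bmat_mult_def bmat_vec_def sum_mult_vec
        by (intro sum.cong) (simp_all add: col flip: matrix_vector_mul_assoc)
      also have "\<dots> = single_bvec j (axis l 1) i" using g True by simp
      finally show ?thesis using True by (auto simp: bmat_id_def single_bvec_def)
    next
      case False
      then show ?thesis by (auto simp: bmat_mult_def Y_def bmat_id_def)
    qed
    then show "bmat_mult S Z Y i j = bmat_id S i j"
      unfolding mult_vec_axis by (simp add: vec_eq_iff)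
  qed
  \<comment> \<open>The right inverse is also a left inverse: \<open>Y Z x - x\<close>, cut down to
    \<open>S\<close>, is killed by the injective \<open>Z\<close>.\<close>
  have "bmat_mult S Y Z = bmat_id S"
  proof (rule bmat_eqI[OF assms(1)])
    show "bmat_mult S Y Z \<in> bmats S S" "bmat_id S \<in> bmats S S"
      using YB assms(2) by (auto simp: bmats_def bmat_mult_def bmat_id_def)
    fix x :: "'r bvec"
    let ?x = "bmat_vec S (bmat_id S) x"
    have "?f ?x = ?f x"
      by (rule bmat_vec_cong) (simp add: bmat_vec_id assms(1))
    have "bmat_vec S (bmat_mult S Y Z) x - ?x = 0"
    proof (rule inj)
      show "(bmat_vec S (bmat_mult S Y Z) x - ?x) i = 0" if "i \<notin> S" for i
        using that by (simp add: bmat_vec_id assms(1) bmat_vec_mult bmat_vec_outside[OF YB])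
      have "?f (bmat_vec S (bmat_mult S Y Z) x) = bmat_vec S (bmat_mult S Z Y) (?f x)"
        by (simp add: bmat_vec_mult)
      also have "\<dots> = ?f x"
        using bmat_vec_outside[OF assms(2)] by (auto simp: ZY bmat_vec_id assms(1))
      finally show "?f (bmat_vec S (bmat_mult S Y Z) x - ?x) = 0"
        using \<open>?f ?x = ?f x\<close> by (simp add: linear_diff[OF lin])
    qed
    then show "bmat_vec S (bmat_mult S Y Z) x = ?x" by simp
  qed
  then show ?thesis
    using YB ZY by (auto simp: bmat_invertible_def is_bmat_inv_def)
qed

section \<open>Results and costs of the parallel primitives\<close>

lemma comp_simps [simp]:
  "result (ret x) = x" "work (ret x) = 0" "depth (ret x) = 0"
  "result (tick x) = x" "work (tick x) = 1" "depth (tick x) = 1"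
  "result (bind_comp m f) = result (f (result m))"
  "work (bind_comp m f) = work m + work (f (result m))"
  "depth (bind_comp m f) = depth m + depth (f (result m))"
  "result (fork m m') = (result m, result m')"
  "work (fork m m') = work m + work m' + 1"
  "depth (fork m m') = max (depth m) (depth m') + 1"
  for f :: "'a \<Rightarrow> 'b comp" and m :: "'a comp" and m' :: "'c comp"
  by (simp_all add: ret_def tick_def bind_comp_def fork_def Let_def)

lemma par_for_halves:
  assumes "2 \<le> length xs"
  shows "par_for f xs = bind_comp
     (fork (par_for f (take (length xs div 2) xs)) (par_for f (drop (length xs div 2) xs)))
     (\<lambda>(u, v). ret (override_on u v (set (drop (length xs div 2) xs))))"
  using assms by (cases "(f, xs)" rule: par_for.cases) (simp_all add: Let_def)

lemma par_sum_halves: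
  assumes "2 \<le> length xs"
  shows "par_sum f xs = bind_comp
     (fork (par_sum f (take (length xs div 2) xs)) (par_sum f (drop (length xs div 2) xs)))
     (\<lambda>(s, t). tick (s + t))"
  using assms by (cases "(f, xs)" rule: par_sum.cases) (simp_all add: Let_def)

lemma halving_induct [case_names Nil single halves]:
  assumes "P []" "\<And>x. P [x]"
    and "\<And>xs. 2 \<le> length xs \<Longrightarrow> P (take (length xs div 2) xs) \<Longrightarrow> P (drop (length xs div 2) xs) \<Longrightarrow> P xs"
  shows "P xs"
proof (induction xs rule: length_induct)
  case (1 xs)
  show ?case
  proof (cases "2 \<le> length xs")
    case True
    then show ?thesis using 1 assms(3) by simp
  next
    case False
    then have "xs = [] \<or> (\<exists>x. xs = [x])"
      by (cases xs; cases "tl xs") auto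
    then show ?thesis using assms(1,2) by auto
  qed
qed

lemma sum_list_halves:
  "(\<Sum>x\<leftarrow>take h xs. f x) + (\<Sum>x\<leftarrow>drop h xs. f x) = (\<Sum>x\<leftarrow>xs. f x)" for f :: "'a \<Rightarrow> 'b::monoid_add"
  by (metis append_take_drop_id map_append sum_list_append)

section \<open>Values, work and depth of the fork trees\<close>

lemma result_par_for: "result (par_for f xs) = (\<lambda>i. if i \<in> set xs then result (f i) else 0)"
proof (induction xs rule: halving_induct)
  case (halves xs)
  have "set xs = set (take (length xs div 2) xs) \<union> set (drop (length xs div 2) xs)"
    by (metis append_take_drop_id set_append)
  then show ?case
    using halves by (auto simp: par_for_halves override_on_def fun_eq_iff)
qed (auto simp: fun_eq_iff)

lemma result_par_sum: "result (par_sum f xs) = (\<Sum>x\<leftarrow>xs. result (f x))"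
proof (induction xs rule: halving_induct)
  case (halves xs)
  then show ?case by (simp add: par_sum_halves sum_list_halves)
qed simp_all

text \<open>A binary tree with \<open>n\<close> leaves has \<open>n - 1\<close> forks; adding 1
  makes the count additive over the halves and the formula exact.\<close>

lemma work_par_for: "xs \<noteq> [] \<Longrightarrow> work (par_for f xs) + 1 = (\<Sum>x\<leftarrow>xs. work (f x) + 1)"
proof (induction xs rule: halving_induct)
  case (halves xs)
  from \<open>2 \<le> length xs\<close>
  have "take (length xs div 2) xs \<noteq> []" "drop (length xs div 2) xs \<noteq> []" by auto
  then show ?case
    using halves sum_list_halves[where h = "length xs div 2" and xs = xs and f = "\<lambda>x. work (f x) + 1"]
    by (simp add: par_for_halves)
qed simp_all

text \<open>Here an inner node costs 2, one fork and one addition, hence the offset 2.\<close>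

lemma work_par_sum: "xs \<noteq> [] \<Longrightarrow> work (par_sum f xs) + 2 = (\<Sum>x\<leftarrow>xs. work (f x) + 2)"
proof (induction xs rule: halving_induct)
  case (halves xs)
  from \<open>2 \<le> length xs\<close>
  have "take (length xs div 2) xs \<noteq> []" "drop (length xs div 2) xs \<noteq> []" by auto
  then show ?case
    using halves sum_list_halves[where h = "length xs div 2" and xs = xs and f = "\<lambda>x. work (f x) + 2"]
    by (simp add: par_sum_halves)
qed simp_all

lemma depth_par_for:
  assumes "\<And>x. x \<in> set xs \<Longrightarrow> depth (f x) \<le> D" "length xs \<le> 2 ^ e"
  shows "depth (par_for f xs) \<le> D + e"
  using assms
proof (induction xs arbitrary: e rule: halving_induct)
  case (halves xs)
  then obtain e' where e: "e = Suc e'" by (cases e) auto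
  have "depth (par_for f (take (length xs div 2) xs)) \<le> D + e'"
    using halves.prems e by (intro halves.IH(1)) (auto dest: in_set_takeD)
  moreover have "depth (par_for f (drop (length xs div 2) xs)) \<le> D + e'"
    using halves.prems e by (intro halves.IH(2)) (auto dest: in_set_dropD)
  ultimately show ?case using halves.hyps e by (simp add: par_for_halves)
qed (auto simp: trans_le_add1)

lemma depth_par_sum:
  assumes "\<And>x. x \<in> set xs \<Longrightarrow> depth (f x) \<le> D" "length xs \<le> 2 ^ e"
  shows "depth (par_sum f xs) \<le> D + 2 * e"
  using assms
proof (induction xs arbitrary: e rule: halving_induct)
  case (halves xs)
  then obtain e' where e: "e = Suc e'" by (cases e) auto
  have "depth (par_sum f (take (length xs div 2) xs)) \<le> D + 2 * e'"
    using halves.prems e by (intro halves.IH(1)) (auto dest: in_set_takeD)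
  moreover have "depth (par_sum f (drop (length xs div 2) xs)) \<le> D + 2 * e'"
    using halves.prems e by (intro halves.IH(2)) (auto dest: in_set_dropD)
  ultimately show ?case using halves.hyps e by (simp add: par_sum_halves)
qed (auto simp: trans_le_add1)

section \<open>Work and depth of the Jacobi algorithm\<close>

text \<open>Row \<open>i\<close> pays \<open>3 * length (nb i) + 1\<close> for its sum, including
  the diagonal term, then three unit instructions and one unit for its share of the forks.\<close>

lemma work_jacobi_sweep:
  assumes "fs \<noteq> []"
  shows "work (jacobi_sweep fs nb L Y b x) + 1 = (\<Sum>i\<leftarrow>fs. 3 * length (nb i) + 5)"
proof -
  have "work (par_sum (\<lambda>j. tick (L i j *v x j)) (i # nb i)) = 3 * length (nb i) + 1" for i
    using work_par_sum[of "i # nb i" "\<lambda>j. tick (L i j *v x j)"] by (simp add: sum_list_triv)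
  then show ?thesis
    unfolding jacobi_sweep_def by (subst work_par_for[OF assms]) (simp add: numeral_eq_Suc)
qed

lemma work_jacobi_loop:
  assumes "fs \<noteq> []"
  shows "work (jacobi_loop k fs nb L Y b x) \<le> k * (\<Sum>i\<leftarrow>fs. 3 * length (nb i) + 5)"
proof (induction k arbitrary: x)
  case (Suc k)
  then show ?case
    using work_jacobi_sweep[OF assms, of nb L Y b x] by (simp add: add_mono)
qed simp

lemma work_jacobi:
  fixes b :: "'r::finite bvec"
  assumes "fs \<noteq> []"
  shows "work (jacobi k fs nb N b) \<le> (5 * k + 10) * (\<Sum>i\<leftarrow>fs. length (nb i) + 1)"
proof -
  let ?m = "\<Sum>i\<leftarrow>fs. length (nb i) + 1"
  have mono: "(\<Sum>i\<leftarrow>fs. f i) \<le> c * ?m" if "\<And>i. f i \<le> c * (length (nb i) + 1)" for f c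
    unfolding sum_list_const_mult[symmetric] using that by (intro sum_list_mono) auto
  have par_for: "work (par_for f fs) \<le> c * ?m"
    if "\<And>i. work (f i) + 1 \<le> c * (length (nb i) + 1)" for c and f :: "nat \<Rightarrow> ('c::zero) comp"
    using mono[of "\<lambda>i. work (f i) + 1" c, OF that] work_par_for[OF assms, of f] by linarith
  have sum_nb: "work (par_sum (\<lambda>j. tick (opnorm (N i j))) (nb i)) \<le> 3 * length (nb i)" for i
    using work_par_sum[of "nb i" "\<lambda>j. tick (opnorm (N i j))"]
    by (cases "nb i = []") (simp_all add: sum_list_triv)
  have diag: "work (par_for (\<lambda>i. bind_comp (par_sum (\<lambda>j. tick (opnorm (N i j))) (nb i))
      (\<lambda>s. tick (s *\<^sub>R (mat 1 :: 'r block)))) fs) \<le> 3 * ?m"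
    using sum_nb by (intro par_for) (auto intro: le_SucI)
  have unit_block: "work (par_for (\<lambda>i. tick (g i)) fs) \<le> 2 * ?m" for g :: "nat \<Rightarrow> 'r block"
    by (intro par_for) auto
  have unit_vec: "work (par_for (\<lambda>i. tick (g i)) fs) \<le> 2 * ?m" for g :: "'r bvec"
    by (intro par_for) auto
  have "(\<Sum>i\<leftarrow>fs. 3 * length (nb i) + 5) \<le> 5 * ?m"
    by (intro mono) auto
  then have loop: "work (jacobi_loop k fs nb L Y b x) \<le> k * (5 * ?m)" for L Y x
    using work_jacobi_loop[OF assms, of k nb L Y b x] by (meson mult_le_mono2 order_trans)
  \<comment> \<open>The summands follow the binds of \<open>jacobi\<close>: diagonal,
    \<open>L\<close>, \<open>X\<close>, \<open>Y\<close>, \<open>k\<close>, start vector, loop. They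
    add up to \<open>9 * ?m + 1\<close> besides the loop, and \<open>1 \<le> ?m\<close> absorbs the
    last unit.\<close>
  have "work (jacobi k fs nb N b)
      \<le> 3 * ?m + (0 + (2 * ?m + (2 * ?m + (1 + (2 * ?m + k * (5 * ?m))))))"
    unfolding jacobi_def comp_simps
    by (intro add_mono diag unit_block unit_vec loop order_refl)
  moreover have "1 \<le> ?m"
    using assms by (cases fs) auto
  ultimately show ?thesis by (simp add: algebra_simps)
qed

text \<open>The bound on \<open>nb i\<close> is strict because the row sum also contains the
  diagonal term.\<close>

lemma depth_jacobi_sweep:
  assumes "length fs \<le> 2 ^ e" "\<And>i. i \<in> set fs \<Longrightarrow> length (nb i) < 2 ^ e"
  shows "depth (jacobi_sweep fs nb L Y b x) \<le> 4 + 3 * e"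
proof -
  have "depth (par_sum (\<lambda>j. tick (L i j *v x j)) (i # nb i)) \<le> 1 + 2 * e" if "i \<in> set fs" for i
    using assms(2)[OF that] by (intro depth_par_sum) auto
  then have "depth (jacobi_sweep fs nb L Y b x) \<le> (4 + 2 * e) + e"
    unfolding jacobi_sweep_def by (intro depth_par_for assms(1)) fastforce
  then show ?thesis by simp
qed

lemma depth_jacobi_loop:
  assumes "length fs \<le> 2 ^ e" "\<And>i. i \<in> set fs \<Longrightarrow> length (nb i) < 2 ^ e"
  shows "depth (jacobi_loop k fs nb L Y b x) \<le> k * (4 + 3 * e)"
proof (induction k arbitrary: x)
  case (Suc k)
  then show ?case
    using depth_jacobi_sweep[OF assms, where L = L and Y = Y and b = b and x = x] by (simp add: add_mono)
qed simp

lemma depth_jacobi: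
  fixes b :: "'r::finite bvec"
  assumes "length fs \<le> 2 ^ e" "\<And>i. i \<in> set fs \<Longrightarrow> length (nb i) < 2 ^ e"
  shows "depth (jacobi k fs nb N b) \<le> 6 + 6 * e + k * (4 + 3 * e)"
proof -
  have "depth (par_sum (\<lambda>j. tick (opnorm (N i j))) (nb i)) \<le> 1 + 2 * e" if "i \<in> set fs" for i
    using assms(2)[OF that] by (intro depth_par_sum) auto
  then have diag: "depth (par_for (\<lambda>i. bind_comp (par_sum (\<lambda>j. tick (opnorm (N i j))) (nb i))
      (\<lambda>s. tick (s *\<^sub>R (mat 1 :: 'r block)))) fs) \<le> (2 + 2 * e) + e"
    by (intro depth_par_for assms(1)) fastforce
  have unit_block: "depth (par_for (\<lambda>i. tick (g i)) fs) \<le> 1 + e" for g :: "nat \<Rightarrow> 'r block"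
    by (intro depth_par_for assms(1)) auto
  have unit_vec: "depth (par_for (\<lambda>i. tick (g i)) fs) \<le> 1 + e" for g :: "'r bvec"
    by (intro depth_par_for assms(1)) auto
  have "depth (jacobi k fs nb N b)
      \<le> ((2 + 2 * e) + e) + (0 + ((1 + e) + ((1 + e) + (1 + ((1 + e) + k * (4 + 3 * e))))))"
    unfolding jacobi_def comp_simps
    by (intro add_mono diag unit_block unit_vec depth_jacobi_loop assms order_refl)
  then show ?thesis by simp
qed

text \<open>One of the two integers after \<open>\<lfloor>log 2 (3 / \<epsilon>)\<rfloor>\<close> is
  odd, and \<open>log 2 3 \<le> 2\<close>, so the count is at most
  \<open>log 2 (1 / \<epsilon>) + 4\<close>. Since \<open>\<epsilon> \<le> 1/2\<close> makes the
  logarithm at least 1, the constant 4 is absorbed.\<close>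

lemma Least_iteration_count:
  assumes "0 < \<epsilon>" "\<epsilon> \<le> 1 / 2"
  shows "real (LEAST k. iteration_count \<epsilon> k) \<le> 5 * log 2 (1 / \<epsilon>)"
proof -
  have l: "1 \<le> log 2 (1 / \<epsilon>)"
    using assms by (subst le_log_iff) (auto simp: field_simps)
  have "log 2 3 \<le> log 2 (4::real)" by simp
  also have "log 2 (4::real) = 2" using log_pow_cancel[of 2 2] by simp
  finally have "log 2 (3 / \<epsilon>) \<le> 2 + log 2 (1 / \<epsilon>)"
    using assms by (simp add: log_divide)
  define m where "m = nat \<lfloor>log 2 (3 / \<epsilon>)\<rfloor>"
  have pos: "0 \<le> log 2 (3 / \<epsilon>)"
    using assms by (simp add: field_simps)
  then have m: "real m \<le> log 2 (3 / \<epsilon>)" "log 2 (3 / \<epsilon>) < real m + 1"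
    unfolding m_def by linarith+
  obtain k where k: "odd k" "m < k" "k \<le> m + 2"
    by (cases "even m") (auto intro: that[of "m + 1"] that[of "m + 2"])
  then have "iteration_count \<epsilon> k"
    using m unfolding iteration_count_def by linarith
  then have "(LEAST k. iteration_count \<epsilon> k) \<le> k" by (rule Least_le)
  then have "real (LEAST k. iteration_count \<epsilon> k) \<le> real m + 2" using k by linarith
  then show ?thesis using m l \<open>log 2 (3 / \<epsilon>) \<le> 2 + log 2 (1 / \<epsilon>)\<close> by linarith
qed

section \<open>The splitting into diagonal and off-diagonal part\<close>

locale jacobi_splitting =
  fixes F :: "nat set" and N :: "'r::finite bmat" and \<alpha> :: real
  assumes finite_F: "finite F"
    and N_bmats: "N \<in> bmats F F"
    and N_dominant: "alpha_bDD \<alpha> F N"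
    and \<alpha>_ge: "4 \<le> \<alpha>"
    and X_invertible: "bmat_invertible F (jacobi_X F N)"
begin

abbreviation "X \<equiv> jacobi_X F N"
abbreviation "L \<equiv> jacobi_L F N"
abbreviation "R \<equiv> bmat_inv F X"
abbreviation "ip \<equiv> bvec_inner F"
abbreviation "op \<equiv> bmat_vec F"

definition T :: "'r bvec \<Rightarrow> 'r bvec" where
  "T x = op R (op L x)"

definition B :: "'r bvec \<Rightarrow> 'r bvec \<Rightarrow> real" where
  "B x y = ip x (op X y)"

lemma X_eq: "X i j = (if i = j \<and> i \<in> F then N i i - offdiag_norm F N i *\<^sub>R mat 1 else 0)"
  using N_bmats by (auto simp: jacobi_X_def jacobi_L_def submat_def bmats_def)

text \<open>The shape \<open>X - (- L)\<close> makes the rule for differences of block matrices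
  applicable.\<close>

lemma N_eq: "N = (\<lambda>i j. X i j - (- L i j))"
  using N_bmats by (auto simp: jacobi_X_def submat_def bmats_def fun_eq_iff)

lemma op_N: "op N x = op X x + op L x"
proof -
  have "op (\<lambda>i j. - L i j) x = - op L x"
    using bmat_vec_scale_mat[of F "- 1" L x] by simp
  moreover have "op N x = op X x - op (\<lambda>i j. - L i j) x"
    by (subst N_eq) (rule bmat_vec_diff_mat)
  ultimately show ?thesis by simp
qed

section \<open>Self-adjointness and size of the two parts\<close>

lemma N_hermitian: "hermitian F N"
  using N_dominant by (simp add: alpha_bDD_def)

lemma L_hermitian: "hermitian F L"
proof -
  have "L i j = conj_transpose (L j i)" if "i \<in> F" "j \<in> F" for i j
  proof (cases "i = j")
    case True
    then show ?thesis by (simp add: jacobi_L_def submat_def conj_transpose_scaled_one)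
  next
    case False
    moreover have "N i j = conj_transpose (N j i)"
      using N_hermitian that unfolding hermitian_def by blast
    ultimately show ?thesis using that by (simp add: jacobi_L_def submat_def)
  qed
  then show ?thesis unfolding hermitian_def by blast
qed

lemma op_L_adjoint: "ip (op L x) y = ip x (op L y)"
  using L_hermitian hermitian_iff[OF finite_F, of L] by simp

lemma op_N_adjoint: "ip (op N x) y = ip x (op N y)"
  using N_hermitian hermitian_iff[OF finite_F, of N] by simp

lemma op_X_adjoint: "ip (op X x) y = ip x (op X y)"
proof -
  have "op X x = op N x - op L x" for x by (simp add: op_N)
  then show ?thesis
    by (simp add: bilinear_lsub[OF bilinear_bvec_inner] bilinear_rsub[OF bilinear_bvec_inner]
        op_L_adjoint op_N_adjoint)
qed

lemma R_inv: "is_bmat_inv F X R"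
  by (rule is_bmat_inv_bmat_inv) (rule X_invertible)

lemma R_bmats: "R \<in> bmats F F"
  using R_inv by (simp add: is_bmat_inv_def)

lemma op_X_R: "i \<in> F \<Longrightarrow> op X (op R x) i = x i" and op_R_X: "i \<in> F \<Longrightarrow> op R (op X x) i = x i"
  using is_bmat_inv_vec[OF finite_F R_inv] by auto

text \<open>The diagonal of \<open>L\<close> is exactly \<open>D\<close>, and its off-diagonal form
  is at most that of \<open>D\<close> in absolute value; so
  \<open>0 \<le> L \<le> 2 D\<close>.\<close>

lemma L_diag_bound: "\<bar>ip x (op L x) - (\<Sum>i\<in>F. offdiag_norm F N i * (norm (x i))\<^sup>2)\<bar>
    \<le> (\<Sum>i\<in>F. offdiag_norm F N i * (norm (x i))\<^sup>2)"
proof -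
  have "(\<Sum>i\<in>F. x i \<bullet> (L i i *v x i)) = (\<Sum>i\<in>F. offdiag_norm F N i * (norm (x i))\<^sup>2)"
    by (intro sum.cong refl)
      (simp add: jacobi_L_def submat_def scaleR_mult_vec power2_norm_eq_inner)
  moreover have "(\<Sum>i\<in>F. \<Sum>j\<in>F - {i}. x i \<bullet> (L i j *v x j)) = (\<Sum>i\<in>F. \<Sum>j\<in>F - {i}. x i \<bullet> (N i j *v x j))"
    by (intro sum.cong refl) (auto simp: jacobi_L_def submat_def)
  ultimately show ?thesis
    using offdiag_form_le[OF finite_F N_hermitian, of x]
    by (simp add: bvec_inner_bmat_vec_diag[OF finite_F, of x L])
qed

lemma L_nonneg: "0 \<le> ip x (op L x)"
  using L_diag_bound[of x] by linarith

text \<open>Removing \<open>D\<close> from the diagonal of \<open>N\<close> still leaves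
  \<open>X \<ge> \<alpha> D\<close>. Together with \<open>L \<le> 2 D\<close>, the value 4 is what
  gives the ratio 1/2.\<close>

lemma L_le_half_X: "ip x (op L x) \<le> B x x / 2"
proof -
  have off: "0 \<le> offdiag_norm F N i" for i
    unfolding offdiag_norm_def by (intro sum_nonneg opnorm_nonneg)
  have diag: "4 * (offdiag_norm F N i * (norm (x i))\<^sup>2) \<le> x i \<bullet> (X i i *v x i)" if "i \<in> F" for i
  proof -
    have "0 \<le> x i \<bullet> ((N i i - ((1 + \<alpha>) * offdiag_norm F N i) *\<^sub>R mat 1) *v x i)"
      using N_dominant that by (intro psd_block_inner) (simp add: alpha_bDD_def)
    then have "\<alpha> * (offdiag_norm F N i * (norm (x i))\<^sup>2) \<le> x i \<bullet> (X i i *v x i)"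
      using that by (simp add: X_eq block_vec_simps scaleR_mult_vec inner_diff_right
          power2_norm_eq_inner algebra_simps)
    moreover have "4 * (offdiag_norm F N i * (norm (x i))\<^sup>2) \<le> \<alpha> * (offdiag_norm F N i * (norm (x i))\<^sup>2)"
      using off \<alpha>_ge by (intro mult_right_mono) simp_all
    ultimately show ?thesis by linarith
  qed
  have "(\<Sum>i\<in>F. \<Sum>j\<in>F - {i}. x i \<bullet> (X i j *v x j)) = 0"
    by (intro sum.neutral ballI) (auto simp: X_eq)
  then have "B x x = (\<Sum>i\<in>F. x i \<bullet> (X i i *v x i))"
    by (simp add: B_def bvec_inner_bmat_vec_diag[OF finite_F, of x X])
  moreover have "4 * (\<Sum>i\<in>F. offdiag_norm F N i * (norm (x i))\<^sup>2) \<le> (\<Sum>i\<in>F. x i \<bullet> (X i i *v x i))"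
    unfolding sum_distrib_left by (intro sum_mono diag)
  ultimately show ?thesis using L_diag_bound[of x] by linarith
qed

lemma B_T: "B x (T y) = ip x (op L y)"
  unfolding B_def T_def by (intro bvec_inner_cong) (simp_all add: op_X_R)

lemma B_commute: "B x y = B y x"
  unfolding B_def by (metis op_X_adjoint bvec_inner_commute)

lemma linear_T: "linear T"
  unfolding T_def using linear_compose[OF linear_bmat_vec[of F L] linear_bmat_vec[of F R]]
  by (simp add: o_def)

lemma bilinear_B: "bilinear B"
proof -
  have lin: "linear (ip x)" "linear (\<lambda>x. ip x y)" for x y
    using bilinear_bvec_inner[of F] unfolding bilinear_def by blast+
  have "linear (\<lambda>y. ip x (op X y))" for x
    using linear_compose[OF linear_bmat_vec[of F X] lin(1)] by (simp add: o_def)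
  then show ?thesis
    unfolding bilinear_def B_def using lin(2) by blast
qed

sublocale half_contraction T B
proof (rule half_contraction.intro)
  show "linear T" by (rule linear_T)
  show "bilinear B" by (rule bilinear_B)
  show "B x y = B y x" for x y by (rule B_commute)
  show "B (T x) y = B x (T y)" for x y
    by (metis B_commute B_T op_L_adjoint bvec_inner_commute)
  show "0 \<le> B (T x) x" for x
    by (metis B_commute B_T L_nonneg)
  show "B (T x) x \<le> B x x / 2" for x
    by (metis B_commute B_T L_le_half_X)
qed

text \<open>Cauchy-Schwarz for a semidefinite form makes a null vector \<open>w\<close> orthogonal
  to every \<open>u\<close>. The choice \<open>u = X w\<close> turns \<open>B u w\<close> into the
  squared norm of \<open>X w\<close> on \<open>F\<close>, and \<open>X\<close> is
  invertible.\<close>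

lemma B_definite:
  assumes "B w w \<le> 0" "i \<in> F"
  shows "w i = 0"
proof -
  have zero: "B w w = 0" using assms(1) B_nonneg[of w] by linarith
  define u where "u = op X w"
  \<comment> \<open>Expand \<open>B\<close> at \<open>w - t *\<^sub>R u\<close>; a suitable
    \<open>t\<close> then forces \<open>B u w = 0\<close>, with a case split because
    \<open>B u u\<close> may vanish.\<close>
  have quad: "2 * t * B u w \<le> t\<^sup>2 * B u u" for t
    using B_nonneg[of "w - t *\<^sub>R u"] zero B_commute[of w u]
    by (simp add: B_simps power2_eq_square algebra_simps)
  have "B u w = 0"
  proof (cases "B u u = 0")
    case True
    then show ?thesis using quad[of "B u w"] by (auto simp: mult_le_0_iff)
  next
    case False
    then have "0 < B u u" using B_nonneg[of u] by simp
    then show ?thesis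
      using quad[of "B u w / B u u"] by (auto simp: power2_eq_square field_simps mult_le_0_iff)
  qed
  then have "ip u u = 0" by (simp add: B_def u_def)
  then have "u j = 0" if "j \<in> F" for j
    using that finite_F by (simp add: bvec_inner_def sum_nonneg_eq_0_iff)
  then have "op R u = op R (\<lambda>_. 0)"
    by (intro bmat_vec_cong) simp
  then show ?thesis
    using op_R_X[OF assms(2), of w] by (simp add: u_def bmat_vec_def)
qed

section \<open>The operator computed by the iteration\<close>

primrec Z :: "nat \<Rightarrow> 'r bmat" where
  "Z 0 = R"
| "Z (Suc t) = (\<lambda>i j. R i j - bmat_mult F R (bmat_mult F L (Z t)) i j)"

lemma op_Z: "op (Z t) b = poly_op T (jacobi_poly t) (op R b)"
  by (induction t)
    (simp_all add: bmat_vec_diff_mat bmat_vec_mult poly_op_T linear_T flip: T_def)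

lemma Z_bmats: "Z t \<in> bmats F F"
  using R_bmats by (induction t) (auto simp: bmats_def bmat_mult_def)

text \<open>On \<open>F\<close> the operator \<open>N\<close> is \<open>X (1 + T)\<close>, so the
  telescoping identity applies; odd \<open>k\<close> makes the sign of the last power
  positive.\<close>

lemma op_N_jacobi_poly:
  assumes "odd k" "i \<in> F"
  shows "op N (poly_op T (jacobi_poly k) w) i = op X w i - op X (poly_op T ([:0, 1:] ^ Suc k) w) i"
proof -
  let ?v = "poly_op T (jacobi_poly k) w"
  have L: "op L x i = op X (T x) i" for x
    using assms(2) by (simp add: T_def op_X_R)
  have "?v + T ?v = poly_op T ([:1, 1:] * jacobi_poly k) w"
    by (simp only: poly_op_T poly_op_0) simp
  also have "\<dots> = w - poly_op T ([:0, 1:] ^ Suc k) w"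
  proof -
    have "(- [:0, 1:]) ^ Suc k = ([:0, 1:] ^ Suc k :: real poly)"
      using assms(1) by (intro power_minus_even) simp
    then show ?thesis
      by (simp only: jacobi_poly_telescope poly_op_diff[OF linear_T] poly_op_1[OF linear_T])
  qed
  finally have *: "?v + T ?v = w - poly_op T ([:0, 1:] ^ Suc k) w" .
  have "op N ?v i = op X (?v + T ?v) i"
    by (simp add: op_N L linear_add[OF linear_bmat_vec])
  then show ?thesis
    unfolding * by (simp add: linear_diff[OF linear_bmat_vec])
qed

text \<open>If \<open>Z b = 0\<close>, then coercivity of \<open>p(T)\<close> and definiteness of
  \<open>B\<close> give \<open>R b = 0\<close> on \<open>F\<close>, whence
  \<open>b = X R b = 0\<close>.\<close>

lemma Z_invertible:
  assumes "odd k"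
  shows "bmat_invertible F (Z k)"
proof (rule bmat_invertible_if_injective[OF finite_F Z_bmats])
  fix b :: "'r bvec"
  assume supp: "\<And>i. i \<notin> F \<Longrightarrow> b i = 0" and "op (Z k) b = 0"
  then have "B (op R b) (op R b) \<le> 0"
    using jacobi_poly_lower[OF assms, of "op R b"] by (simp add: op_Z B_simps)
  then have "op X (op R b) = op X (\<lambda>_. 0)"
    by (intro bmat_vec_cong B_definite)
  then have "op X (op R b) = (\<lambda>_. 0)"
    by (simp add: bmat_vec_def)
  then have "b i = 0" if "i \<in> F" for i
    using op_X_R[OF that, of b] by simp
  then show "b = 0"
    using supp by (auto simp: fun_eq_iff)
qed

abbreviation "residual k \<equiv> (\<lambda>i j. bmat_inv F (Z k) i j - N i j)"

text \<open>Take \<open>b = Z\<inverse> v\<close> and \<open>w = R b\<close>: then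
  \<open>Z\<inverse> v = X w\<close>, and subtracting \<open>N v\<close> cancels this term. The
  equations are confined to \<open>F\<close> because \<open>v\<close> is arbitrary
  elsewhere.\<close>

lemma residual_form:
  assumes "odd k"
  obtains w where "\<And>i. i \<in> F \<Longrightarrow> v i = poly_op T (jacobi_poly k) w i"
    "\<And>i. i \<in> F \<Longrightarrow> op (residual k) v i = op X (poly_op T ([:0, 1:] ^ Suc k) w) i"
proof
  define b where "b = op (bmat_inv F (Z k)) v"
  let ?w = "op R b"
  show v: "v i = poly_op T (jacobi_poly k) ?w i" if "i \<in> F" for i
    using is_bmat_inv_vec(1)[OF finite_F is_bmat_inv_bmat_inv[OF Z_invertible[OF assms]] that, of v]
    by (simp add: b_def op_Z)
  show "op (residual k) v i = op X (poly_op T ([:0, 1:] ^ Suc k) ?w) i" if "i \<in> F" for i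
  proof -
    have "op N v = op N (poly_op T (jacobi_poly k) ?w)"
      by (intro bmat_vec_cong v)
    then show ?thesis
      using op_N_jacobi_poly[OF assms that, of ?w] op_X_R[OF that, of b]
      by (simp add: bmat_vec_diff_mat b_def)
  qed
qed

text \<open>Both polynomials in \<open>T\<close> are self-adjoint for \<open>B\<close> and
  commute.\<close>

lemma residual_hermitian:
  assumes "odd k"
  shows "hermitian F (residual k)"
  unfolding hermitian_iff[OF finite_F]
proof (intro allI)
  fix u v
  let ?p = "poly_op T (jacobi_poly k)" and ?q = "poly_op T ([:0, 1:] ^ Suc k)"
  obtain w where
    w: "\<And>i. i \<in> F \<Longrightarrow> u i = ?p w i" "\<And>i. i \<in> F \<Longrightarrow> op (residual k) u i = op X (?q w) i"
    using residual_form[OF assms, of u] by blast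
  obtain w' where
    w': "\<And>i. i \<in> F \<Longrightarrow> v i = ?p w' i" "\<And>i. i \<in> F \<Longrightarrow> op (residual k) v i = op X (?q w') i"
    using residual_form[OF assms, of v] by blast
  have "ip u (op (residual k) v) = B (?p w) (?q w')"
    unfolding B_def by (intro bvec_inner_cong w w')
  also have "\<dots> = B w (?p (?q w'))"
    by (rule poly_op_adjoint)
  also have "?p (?q w') = ?q (?p w')"
    by (metis poly_op_mult[OF linear_T] mult.commute)
  also have "B w (?q (?p w')) = B (?q w) (?p w')"
    by (rule poly_op_adjoint[symmetric])
  also have "\<dots> = ip (op X (?q w)) (?p w')"
    by (simp add: B_def op_X_adjoint)
  also have "\<dots> = ip (op (residual k) u) v"
    by (intro bvec_inner_cong w[symmetric] w'[symmetric])
  finally show "ip u (op (residual k) v) = ip (op (residual k) u) v" .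
qed

lemma residual_bounds:
  assumes "odd k"
  shows "0 \<le> ip v (op (residual k) v)"
    "ip v (op (residual k) v) \<le> 2 * (1/2) ^ k * ip v (op L v)"
proof -
  let ?p = "poly_op T (jacobi_poly k)" and ?q = "poly_op T ([:0, 1:] ^ Suc k)"
  obtain w where
    w: "\<And>i. i \<in> F \<Longrightarrow> v i = ?p w i" "\<And>i. i \<in> F \<Longrightarrow> op (residual k) v i = op X (?q w) i"
    using residual_form[OF assms, of v] by blast
  have form: "ip v (op (residual k) v) = B (?p w) (?q w)"
    unfolding B_def by (intro bvec_inner_cong w)
  show "0 \<le> ip v (op (residual k) v)"
    using jacobi_gap_nonneg[OF assms, of w] by (simp only: form)
  have L: "op L v = op L (?p w)"
    by (intro bmat_vec_cong w)
  have "ip v (op L v) = B (?p w) (T (?p w))"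
    unfolding B_T L by (intro bvec_inner_cong w refl)
  then show "ip v (op (residual k) v) \<le> 2 * (1/2) ^ k * ip v (op L v)"
    using jacobi_gap_le[OF assms, of w] by (simp only: form)
qed

section \<open>The result of the algorithm\<close>

lemma op_X: "i \<in> F \<Longrightarrow> op X x i = X i i *v x i"
proof -
  assume i: "i \<in> F"
  have "op X x i = (\<Sum>j\<in>F. if j = i then X i i *v x i else 0)"
    unfolding bmat_vec_def by (intro sum.cong) (auto simp: X_eq)
  then show ?thesis using i finite_F by simp
qed

text \<open>The algorithm inverts single blocks, whereas the analysis uses the inverse
  \<open>R\<close> of the whole matrix; the diagonal blocks of \<open>R\<close> connect the
  two.\<close>

lemma X_diag_invertible:
  assumes "i \<in> F"
  shows "invertible (X i i)"
proof -
  have "X i i *v (R i i *v v) = v" for v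
  proof -
    have "X i i *v (R i i *v v) = op X (op R (single_bvec i v)) i"
      using assms finite_F by (simp add: op_X bmat_vec_single)
    then show ?thesis using op_X_R[OF assms] by (simp add: single_bvec_def)
  qed
  then have "X i i ** R i i = mat 1"
    unfolding matrix_eq matrix_vector_mul_assoc[symmetric] by simp
  then show ?thesis
    unfolding invertible_def using matrix_left_right_inverse by blast
qed

lemma matrix_inv_diag:
  assumes "i \<in> F"
  shows "matrix_inv (X i i) *v y i = op R y i"
proof -
  have "matrix_inv (X i i) *v y i = matrix_inv (X i i) *v (X i i *v op R y i)"
    using op_X_R[OF assms, of y] by (simp add: op_X assms)
  also have "\<dots> = op R y i"
    by (simp add: matrix_vector_mul_assoc matrix_inv_mult[OF X_diag_invertible[OF assms]])
  finally show ?thesis .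
qed

text \<open>The skipped columns have zero blocks. Outside \<open>F\<close> both sides are 0, since
  \<open>par_for\<close> fills unlisted cells with 0 and \<open>R\<close> has no rows there, so the
  equation holds between whole functions.\<close>

lemma result_jacobi_sweep:
  assumes repr: "sparse_repr F N fs nb"
    and L': "\<And>i. i \<in> F \<Longrightarrow> L' i i = L i i" "\<And>i j. i \<noteq> j \<Longrightarrow> L' i j = N i j"
    and Y: "\<And>i. i \<in> F \<Longrightarrow> Y i = matrix_inv (X i i)"
  shows "result (jacobi_sweep fs nb L' Y b x) = op R b - T x"
proof
  fix i
  show "result (jacobi_sweep fs nb L' Y b x) i = (op R b - T x) i"
  proof (cases "i \<in> F")
    case True
    have nb: "distinct (nb i)" "set (nb i) = {j \<in> F. j \<noteq> i \<and> N i j \<noteq> 0}"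
      using repr True by (auto simp: sparse_repr_def)
    have "(\<Sum>j\<leftarrow>i # nb i. L' i j *v x j) = (\<Sum>j\<in>insert i (set (nb i)). L' i j *v x j)"
      using nb by (subst sum_list_distinct_conv_sum_set) auto
    also have "\<dots> = (\<Sum>j\<in>F. L i j *v x j)"
    proof (rule sum.mono_neutral_cong_left)
      show "finite F" by (rule finite_F)
      show "insert i (set (nb i)) \<subseteq> F" using True nb by auto
      show "\<forall>j\<in>F - insert i (set (nb i)). L i j *v x j = 0"
      proof
        fix j assume "j \<in> F - insert i (set (nb i))"
        then have "j \<noteq> i" "N i j = 0" using nb(2) by blast+
        then show "L i j *v x j = 0" by (simp add: jacobi_L_def submat_def)
      qed
      show "L' i j *v x j = L i j *v x j" if "j \<in> insert i (set (nb i))" for j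
        using that True nb L' by (cases "j = i") (auto simp: jacobi_L_def submat_def)
    qed
    finally have "(\<Sum>j\<leftarrow>i # nb i. L' i j *v x j) = op L x i"
      by (simp add: bmat_vec_def)
    moreover have "i \<in> set fs" using repr True by (simp add: sparse_repr_def)
    ultimately show ?thesis
      using Y[OF True] matrix_inv_diag[OF True, of "op L x"] matrix_inv_diag[OF True, of b]
      by (simp add: jacobi_sweep_def result_par_for result_par_sum T_def del: sum_list.Cons list.map)
  next
    case False
    then show ?thesis
      using repr
      by (simp add: jacobi_sweep_def result_par_for sparse_repr_def T_def bmat_vec_outside[OF R_bmats])
  qed
qed

lemma result_jacobi_loop:
  assumes "sparse_repr F N fs nb"
    and "\<And>i. i \<in> F \<Longrightarrow> L' i i = L i i" "\<And>i j. i \<noteq> j \<Longrightarrow> L' i j = N i j"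
    and "\<And>i. i \<in> F \<Longrightarrow> Y i = matrix_inv (X i i)"
  shows "result (jacobi_loop k fs nb L' Y b x) = ((\<lambda>x. op R b - T x) ^^ k) x"
  by (induction k arbitrary: x)
    (simp_all add: result_jacobi_sweep[OF assms] funpow_Suc_right del: funpow.simps(2))

lemma op_Z_funpow: "op (Z k) b = ((\<lambda>x. op R b - T x) ^^ k) (op R b)"
  by (induction k) (simp_all add: bmat_vec_diff_mat bmat_vec_mult T_def)

lemma result_jacobi:
  assumes repr: "sparse_repr F N fs nb"
  shows "result (jacobi k fs nb N b) = op (Z k) b"
proof -
  have F: "set fs = F" using repr by (simp add: sparse_repr_def)
  define d where "d = result (par_for (\<lambda>i. bind_comp (par_sum (\<lambda>j. tick (opnorm (N i j))) (nb i))
      (\<lambda>s. tick (s *\<^sub>R (mat 1 :: 'r block)))) fs)"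
  define L' where "L' = (\<lambda>i j. if i = j then d i else N i j)"
  define X' where "X' = result (par_for (\<lambda>i. tick (N i i - L' i i)) fs)"
  define Y where "Y = result (par_for (\<lambda>i. tick (matrix_inv (X' i))) fs)"
  define x where "x = result (par_for (\<lambda>i. tick (Y i *v b i)) fs)"
  have "result (jacobi k fs nb N b) = result (jacobi_loop k fs nb L' Y b x)"
    unfolding jacobi_def comp_simps d_def L'_def X'_def Y_def x_def ..
  moreover have d: "d i = L i i" if "i \<in> F" for i
  proof -
    have nb: "distinct (nb i)" "set (nb i) = {j \<in> F. j \<noteq> i \<and> N i j \<noteq> 0}"
      using repr that by (auto simp: sparse_repr_def)
    have "(\<Sum>j\<leftarrow>nb i. opnorm (N i j)) = (\<Sum>j\<in>set (nb i). opnorm (N i j))"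
      using nb(1) by (simp add: sum_list_distinct_conv_sum_set)
    also have "\<dots> = offdiag_norm F N i"
      unfolding offdiag_norm_def
    proof (rule sum.mono_neutral_left)
      show "finite (F - {i})" using finite_F by simp
      show "set (nb i) \<subseteq> F - {i}" using nb(2) by blast
      show "\<forall>j\<in>F - {i} - set (nb i). opnorm (N i j) = 0"
      proof
        fix j assume "j \<in> F - {i} - set (nb i)"
        then have "N i j = 0" using nb(2) by blast
        then show "opnorm (N i j) = 0" by simp
      qed
    qed
    finally show ?thesis
      using that by (simp add: d_def result_par_for result_par_sum F jacobi_L_def submat_def)
  qed
  have X': "X' i = X i i" if "i \<in> F" for i
    using that by (simp add: X'_def result_par_for F L'_def d jacobi_X_def submat_def)
  have Y: "Y i = matrix_inv (X i i)" if "i \<in> F" for i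
    using that by (simp add: Y_def result_par_for F X')
  have "x = op R b"
  proof
    show "x i = op R b i" for i
      using bmat_vec_outside[OF R_bmats, of i b]
      by (simp add: x_def result_par_for F Y matrix_inv_diag)
  qed
  moreover have "result (jacobi_loop k fs nb L' Y b x) = ((\<lambda>x. op R b - T x) ^^ k) x"
    by (rule result_jacobi_loop[OF repr]) (auto simp: L'_def d Y)
  ultimately show ?thesis by (simp add: op_Z_funpow)
qed

text \<open>If the block were zero, dominance would force the off-diagonal norm of the row to
  vanish, and \<open>X i i\<close> would be zero. This lets the constant work per row be charged to
  the diagonal block.\<close>

lemma N_diag_nonzero:
  assumes "i \<in> F"
  shows "N i i \<noteq> 0"
proof
  assume zero: "N i i = 0"
  have off: "0 \<le> offdiag_norm F N i"
    unfolding offdiag_norm_def by (intro sum_nonneg opnorm_nonneg)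
  have "X i i *v v = 0" for v
  proof -
    have "0 \<le> v \<bullet> ((N i i - ((1 + \<alpha>) * offdiag_norm F N i) *\<^sub>R mat 1) *v v)"
      using N_dominant assms by (intro psd_block_inner) (simp add: alpha_bDD_def)
    then have "(1 + \<alpha>) * offdiag_norm F N i * (v \<bullet> v) \<le> 0"
      by (simp add: zero uminus_mult_vec block_vec_simps scaleR_mult_vec inner_diff_right)
    moreover have "0 \<le> (1 + \<alpha>) * offdiag_norm F N i * (v \<bullet> v)"
      using off \<alpha>_ge by (intro mult_nonneg_nonneg) auto
    ultimately have "(1 + \<alpha>) * offdiag_norm F N i * (v \<bullet> v) = 0" by linarith
    then have "offdiag_norm F N i *\<^sub>R v = 0" using \<alpha>_ge by auto
    then show ?thesis
      using assms by (simp add: X_eq zero uminus_mult_vec block_vec_simps scaleR_mult_vec)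
  qed
  then have "v = 0" for v :: "complex^'r"
    using arg_cong[OF matrix_inv_mult[OF X_diag_invertible[OF assms]], of "\<lambda>A. A *v v"]
    by (simp add: block_vec_simps flip: matrix_vector_mul_assoc)
  \<comment> \<open>Any unit vector is a nonzero witness, so the choice of index is
    immaterial.\<close>
  from this[of "axis undefined 1"] show False
    by (simp add: axis_eq_0_iff)
qed

lemma nnz_blocks_eq:
  assumes "sparse_repr F N fs nb"
  shows "nnz_blocks F N = (\<Sum>i\<leftarrow>fs. length (nb i) + 1)"
proof -
  have "{(i, j). i \<in> F \<and> j \<in> F \<and> N i j \<noteq> 0} = (SIGMA i:F. insert i (set (nb i)))"
    using assms N_diag_nonzero by (auto simp: sparse_repr_def)
  then have "nnz_blocks F N = (\<Sum>i\<in>F. card (insert i (set (nb i))))"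
    using finite_F by (simp add: nnz_blocks_def card_SigmaI)
  also have "\<dots> = (\<Sum>i\<in>F. length (nb i) + 1)"
  proof (rule sum.cong)
    fix i assume "i \<in> F"
    then have "distinct (nb i)" "i \<notin> set (nb i)"
      using assms by (simp_all add: sparse_repr_def)
    then show "card (insert i (set (nb i))) = length (nb i) + 1"
      by (simp add: distinct_card)
  qed simp
  also have "\<dots> = (\<Sum>i\<leftarrow>fs. length (nb i) + 1)"
    using assms by (simp add: sparse_repr_def sum_list_distinct_conv_sum_set)
  finally show ?thesis .
qed

end

section \<open>Comparison with the Schur complement\<close>

text \<open>Subtracting the splitting's \<open>L\<close> from the \<open>F\<close>-block removes exactly the off-diagonal norm within
  \<open>F\<close> from both sides of the dominance condition.\<close>

lemma bDD_minus_jacobi_L: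
  assumes "finite V" "bDD V M" "F \<subseteq> V"
  shows "bDD V (\<lambda>i j. M i j - jacobi_L F (submat M F F) i j)"
proof -
  let ?N = "submat M F F"
  let ?L = "jacobi_L F ?N"
  let ?A = "\<lambda>i j. M i j - ?L i j"
  have L_off: "?L i j = (if i \<in> F \<and> j \<in> F then M i j else 0)" if "i \<noteq> j" for i j
    using that by (simp add: jacobi_L_def submat_def)
  have L_diag: "?L i i = (if i \<in> F then offdiag_norm F ?N i *\<^sub>R mat 1 else 0)" for i
    by (simp add: jacobi_L_def submat_def)
  have herm: "?A i j = conj_transpose (?A j i)" if "i \<in> V" "j \<in> V" for i j
  proof -
    have M: "M i j = conj_transpose (M j i)"
      using assms(2) that unfolding bDD_def hermitian_def by blast
    show ?thesis
    proof (cases "i = j")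
      case True
      have "conj_transpose (M j j) = M j j" using M unfolding True by (rule sym)
      then show ?thesis by (simp add: True L_diag conj_transpose_diff conj_transpose_scaled_one)
    next
      case False
      then show ?thesis using M by (simp add: L_off conj_transpose_diff)
    qed
  qed
  have off: "offdiag_norm V M i = (if i \<in> F then offdiag_norm F ?N i else 0) + offdiag_norm V ?A i"
    if "i \<in> V" for i
  proof -
    have N: "(if i \<in> F then offdiag_norm F ?N i else 0)
        = (\<Sum>j\<in>V - {i}. if i \<in> F \<and> j \<in> F then opnorm (M i j) else 0)"
    proof (cases "i \<in> F")
      case True
      have "(\<Sum>j\<in>V - {i}. if i \<in> F \<and> j \<in> F then opnorm (M i j) else 0)
          = (\<Sum>j\<in>(V - {i}) \<inter> F. opnorm (M i j))"
        using assms(1) True by (simp add: sum.inter_restrict)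
      also have "(V - {i}) \<inter> F = F - {i}" using assms(3) by blast
      also have "(\<Sum>j\<in>F - {i}. opnorm (M i j)) = offdiag_norm F ?N i"
        unfolding offdiag_norm_def using True by (intro sum.cong) (simp_all add: submat_def)
      finally show ?thesis using True by simp
    qed simp
    show ?thesis
      unfolding N unfolding offdiag_norm_def sum.distrib[symmetric]
      by (intro sum.cong refl) (auto simp: L_off)
  qed
  have diag: "?A i i - offdiag_norm V ?A i *\<^sub>R mat 1 = M i i - offdiag_norm V M i *\<^sub>R mat 1" if "i \<in> V" for i
    by (simp add: off[OF that] L_diag scaleR_add_left)
  have "hermitian V ?A"
    unfolding hermitian_def using herm by blast
  moreover have "psd_block (?A i i - offdiag_norm V ?A i *\<^sub>R mat 1)" if "i \<in> V" for i
    unfolding diag[OF that] using assms(2) that by (simp add: bDD_def)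
  ultimately show ?thesis by (simp add: bDD_def)
qed

locale schur_elimination =
  fixes V F :: "nat set" and M :: "'r::finite bmat"
  assumes finite_V: "finite V"
    and F_subset: "F \<subseteq> V"
    and M_bDD: "bDD V M"
    and M_CC_invertible: "bmat_invertible (V - F) (submat M (V - F) (V - F))"
begin

abbreviation "C \<equiv> V - F"
abbreviation "K \<equiv> bmat_inv C (submat M C C)"

text \<open>The values on \<open>C\<close> solve \<open>M_CC z = - M_CF x\<close>, so that
  \<open>M\<close> applied to the extension vanishes on \<open>C\<close>.\<close>

definition harmonic_extension :: "'r bvec \<Rightarrow> 'r bvec" where
  "harmonic_extension x =
     (\<lambda>i. if i \<in> F then x i else - bmat_vec C K (bmat_vec F (submat M C F) x) i)"

lemma schur_vec: "bmat_vec F (schur V M C) x =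
    bmat_vec F (submat M F F) x
    - bmat_vec C (submat M F C) (bmat_vec C K (bmat_vec F (submat M C F) x))"
proof -
  have "V - C = F" using F_subset by blast
  then show ?thesis
    by (simp add: schur_def Let_def bmat_vec_diff_mat bmat_vec_mult)
qed

lemma M_harmonic_extension:
  assumes "i \<in> V"
  shows "bmat_vec V M (harmonic_extension x) i = (if i \<in> F then bmat_vec F (schur V M C) x i else 0)"
proof -
  let ?y = "bmat_vec F (submat M C F) x"
  have "bmat_vec V M (harmonic_extension x) i
      = (\<Sum>j\<in>F. M i j *v harmonic_extension x j) + (\<Sum>j\<in>C. M i j *v harmonic_extension x j)"
    unfolding bmat_vec_def using sum.subset_diff[OF F_subset finite_V] by (simp add: add.commute)
  also have "(\<Sum>j\<in>F. M i j *v harmonic_extension x j) = (\<Sum>j\<in>F. M i j *v x j)"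
    by (simp add: harmonic_extension_def)
  also have "(\<Sum>j\<in>C. M i j *v harmonic_extension x j) = - (\<Sum>j\<in>C. M i j *v bmat_vec C K ?y j)"
    by (simp add: harmonic_extension_def block_vec_simps sum_negf)
  finally have split: "bmat_vec V M (harmonic_extension x) i
      = (\<Sum>j\<in>F. M i j *v x j) - (\<Sum>j\<in>C. M i j *v bmat_vec C K ?y j)"
    by simp
  show ?thesis
  proof (cases "i \<in> F")
    case True
    have "(\<Sum>j\<in>F. M i j *v x j) = bmat_vec F (submat M F F) x i"
      unfolding bmat_vec_def using True by (intro sum.cong) (simp_all add: submat_def)
    moreover have "(\<Sum>j\<in>C. M i j *v bmat_vec C K ?y j) = bmat_vec C (submat M F C) (bmat_vec C K ?y) i"
      unfolding bmat_vec_def[of C "submat M F C"] using True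
      by (intro sum.cong) (simp_all add: submat_def)
    ultimately show ?thesis using True by (simp add: split schur_vec)
  next
    case False
    then have i: "i \<in> C" using assms by blast
    have "(\<Sum>j\<in>C. M i j *v bmat_vec C K ?y j) = bmat_vec C (submat M C C) (bmat_vec C K ?y) i"
      unfolding bmat_vec_def[of C "submat M C C"] using i by (intro sum.cong) (simp_all add: submat_def)
    also have "\<dots> = ?y i"
      using finite_V is_bmat_inv_vec(1)[OF _ is_bmat_inv_bmat_inv[OF M_CC_invertible] i] by simp
    also have "?y i = (\<Sum>j\<in>F. M i j *v x j)"
      unfolding bmat_vec_def using i by (intro sum.cong) (simp_all add: submat_def)
    finally show ?thesis using False by (simp add: split)
  qed
qed

text \<open>Stated for two vectors so that the Schur complement also inherits the Hermitian property
  from \<open>M\<close>.\<close>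

lemma schur_form: "bvec_inner V (harmonic_extension y) (bmat_vec V M (harmonic_extension x))
    = bvec_inner F y (bmat_vec F (schur V M C) x)"
proof -
  have "bvec_inner V (harmonic_extension y) (bmat_vec V M (harmonic_extension x))
      = (\<Sum>i\<in>V. if i \<in> F then y i \<bullet> bmat_vec F (schur V M C) x i else 0)"
    unfolding bvec_inner_def
    by (intro sum.cong refl) (simp add: M_harmonic_extension, simp add: harmonic_extension_def)
  also have "\<dots> = (\<Sum>i\<in>V \<inter> F. y i \<bullet> bmat_vec F (schur V M C) x i)"
    using finite_V by (simp add: sum.inter_restrict)
  also have "V \<inter> F = F" using F_subset by blast
  finally show ?thesis by (simp add: bvec_inner_def)
qed

lemma schur_hermitian: "hermitian F (schur V M C)"
proof -
  have "finite F" using finite_V F_subset by (rule rev_finite_subset)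
  moreover have "bvec_inner V x (bmat_vec V M y) = bvec_inner V (bmat_vec V M x) y" for x y
    using M_bDD hermitian_iff[OF finite_V] unfolding bDD_def by blast
  ultimately show ?thesis
    unfolding hermitian_iff[OF \<open>finite F\<close>]
    by (metis schur_form bvec_inner_commute)
qed

lemma jacobi_L_le_schur:
  "bvec_inner F x (bmat_vec F (jacobi_L F (submat M F F)) x)
    \<le> bvec_inner F x (bmat_vec F (schur V M C) x)"
proof -
  let ?L = "jacobi_L F (submat M F F)" and ?z = "harmonic_extension x"
  have L: "?L i j = 0" if "i \<notin> F \<or> j \<notin> F" for i j
    using that by (auto simp: jacobi_L_def submat_def)
  have fin: "finite F" using finite_V F_subset by (rule rev_finite_subset)
  have "bmat_vec V ?L ?z i = bmat_vec F ?L x i" for i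
    unfolding bmat_vec_def using finite_V F_subset
    by (intro sum.mono_neutral_cong_right ballI) (auto simp: L harmonic_extension_def)
  then have "bvec_inner V ?z (bmat_vec V ?L ?z) = bvec_inner V ?z (bmat_vec F ?L x)"
    by (simp add: bvec_inner_def)
  also have "\<dots> = bvec_inner F x (bmat_vec F ?L x)"
    unfolding bvec_inner_def using finite_V F_subset
    by (intro sum.mono_neutral_cong_right ballI) (auto simp: L harmonic_extension_def bmat_vec_def)
  finally have "bvec_inner V ?z (bmat_vec V ?L ?z) = bvec_inner F x (bmat_vec F ?L x)" .
  moreover have "0 \<le> bvec_inner V ?z (bmat_vec V (\<lambda>i j. M i j - ?L i j) ?z)"
    by (intro bDD_form_nonneg bDD_minus_jacobi_L finite_V M_bDD F_subset)
  ultimately show ?thesis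
    by (simp add: bmat_vec_diff_mat bvec_inner_diff_right schur_form)
qed

end

section \<open>Accuracy, work and depth of the Jacobi algorithm\<close>

lemma (in jacobi_splitting) residual_le:
  assumes "finite V" "bDD V M" "F \<subseteq> V" "N = submat M F F"
    and "bmat_invertible (V - F) (submat M (V - F) (V - F))"
    and \<epsilon>: "0 < \<epsilon>" "iteration_count \<epsilon> k"
  shows "loewner_le F (residual k) (\<lambda>i j. \<epsilon> *\<^sub>R schur V M (V - F) i j)"
proof -
  interpret schur_elimination V F M
    by unfold_locales (use assms in auto)
  let ?S = "schur V M (V - F)"
  have k: "odd k" "log 2 (3 / \<epsilon>) < real k"
    using \<epsilon>(2) by (auto simp: iteration_count_def)
  \<comment> \<open>Gives \<open>2 (1/2)^k < 2 \<epsilon> / 3\<close>, so the factor 2 from the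
    lower bound on \<open>p\<close> fits below \<open>\<epsilon>\<close>.\<close>
  have "3 / \<epsilon> < 2 ^ k"
    using k(2) \<epsilon>(1) by (simp add: log_less_iff powr_realpow)
  then have "2 * (1/2) ^ k \<le> \<epsilon>"
    using \<epsilon>(1) by (simp add: field_simps)
  have op_diff: "op (\<lambda>i j. \<epsilon> *\<^sub>R ?S i j - residual k i j) x = \<epsilon> *\<^sub>R op ?S x - op (residual k) x" for x
    by (simp only: bmat_vec_diff_mat bmat_vec_scale_mat)
  have S_sym: "ip x (op ?S y) = ip (op ?S x) y" for x y
    using schur_hermitian hermitian_iff[OF finite_F] by blast
  have res_sym: "ip x (op (residual k) y) = ip (op (residual k) x) y" for x y
    using residual_hermitian[OF k(1)] hermitian_iff[OF finite_F] by blast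
  note ip_simps = bilinear_lsub[OF bilinear_bvec_inner] bilinear_rsub[OF bilinear_bvec_inner]
    bilinear_lmul[OF bilinear_bvec_inner] bilinear_rmul[OF bilinear_bvec_inner]
  have "hermitian F (\<lambda>i j. \<epsilon> *\<^sub>R ?S i j - residual k i j)"
    unfolding hermitian_iff[OF finite_F] op_diff ip_simps S_sym res_sym by blast
  moreover have "0 \<le> ip x (op (\<lambda>i j. \<epsilon> *\<^sub>R ?S i j - residual k i j) x)" for x
  proof -
    have "ip x (op (residual k) x) \<le> 2 * (1/2) ^ k * ip x (op L x)"
      by (rule residual_bounds(2)[OF k(1)])
    also have "\<dots> \<le> \<epsilon> * ip x (op L x)"
      using \<open>2 * (1/2) ^ k \<le> \<epsilon>\<close> L_nonneg by (rule mult_right_mono)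
    also have "\<dots> \<le> \<epsilon> * ip x (op ?S x)"
      using jacobi_L_le_schur[of x] \<epsilon>(1) assms(4) by (intro mult_left_mono) auto
    finally show ?thesis
      unfolding op_diff ip_simps by simp
  qed
  ultimately show ?thesis
    unfolding loewner_le_def psd_iff by blast
qed

lemma (in jacobi_splitting) residual_nonneg:
  assumes "odd k"
  shows "loewner_le F (\<lambda>i j. 0) (residual k)"
  using residual_hermitian[OF assms] residual_bounds(1)[OF assms]
  by (simp only: loewner_le_def psd_iff diff_zero) blast

lemma (in jacobi_splitting) work_le:
  assumes "sparse_repr F N fs nb" "F \<noteq> {}" "0 < \<epsilon>" "\<epsilon> \<le> 1 / 2"
  shows "real (work (jacobi (LEAST k. iteration_count \<epsilon> k) fs nb N b))
    \<le> 100 * real (nnz_blocks F N) * log 2 (1 / \<epsilon>)"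
proof -
  define k where "k = (LEAST k. iteration_count \<epsilon> k)"
  have l: "1 \<le> log 2 (1 / \<epsilon>)"
    using assms by (subst le_log_iff) (auto simp: field_simps)
  have "fs \<noteq> []" using assms by (auto simp: sparse_repr_def)
  from work_jacobi[OF this, of k nb N b]
  have "work (jacobi k fs nb N b) \<le> (5 * k + 10) * nnz_blocks F N"
    by (simp add: nnz_blocks_eq[OF assms(1)])
  then have "real (work (jacobi k fs nb N b)) \<le> (5 * real k + 10) * real (nnz_blocks F N)"
    by (simp flip: of_nat_le_iff[where 'a = real])
  \<comment> \<open>Already 35 would do, by \<open>k \<le> 5 log 2 (1 / \<epsilon>)\<close> and
    \<open>log 2 (1 / \<epsilon>) \<ge> 1\<close>; 100 is shared with the depth bound.\<close>
  also have "\<dots> \<le> (100 * log 2 (1 / \<epsilon>)) * real (nnz_blocks F N)"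
    using Least_iteration_count[OF assms(3,4)] l by (intro mult_right_mono) (simp_all add: k_def)
  finally show ?thesis by (simp add: k_def mult_ac)
qed

lemma (in jacobi_splitting) depth_le:
  assumes "sparse_repr F N fs nb" "finite V" "F \<subseteq> V" "2 \<le> card V" "0 < \<epsilon>" "\<epsilon> \<le> 1 / 2"
  shows "real (depth (jacobi (LEAST k. iteration_count \<epsilon> k) fs nb N b))
    \<le> 100 * log 2 (real (card V)) * log 2 (1 / \<epsilon>)"
proof -
  define k where "k = (LEAST k. iteration_count \<epsilon> k)"
  define l where "l = log 2 (1 / \<epsilon>)"
  define lv where "lv = log 2 (real (card V))"
  define e where "e = nat \<lceil>lv\<rceil>"
  have l: "1 \<le> l"
    using assms unfolding l_def by (subst le_log_iff) (auto simp: field_simps)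
  have k: "real k \<le> 5 * l"
    unfolding k_def l_def by (rule Least_iteration_count[OF assms(5,6)])
  have lv: "1 \<le> lv"
    using assms(4) unfolding lv_def by (subst le_log_iff) auto
  have e: "lv \<le> real e" "real e \<le> 2 * lv" "1 \<le> real e"
    using lv unfolding e_def by linarith+
  have "real (card V) = 2 powr lv"
    using assms(4) by (simp add: lv_def)
  also have "\<dots> \<le> 2 powr real e"
    using e by (intro powr_mono) auto
  finally have "real (card V) \<le> real (2 ^ e)"
    by (simp add: powr_realpow)
  then have card_V: "card V \<le> 2 ^ e"
    by (simp only: of_nat_le_iff)
  have card_F: "card F \<le> card V"
    by (rule card_mono[OF assms(2,3)])
  have "length fs = card F"
    using assms(1) unfolding sparse_repr_def by (metis distinct_card)
  then have "length fs \<le> 2 ^ e" using card_V card_F by linarith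
  moreover have "length (nb i) < 2 ^ e" if "i \<in> set fs" for i
  proof -
    have i: "i \<in> F" using that assms(1) by (simp add: sparse_repr_def)
    have "set (nb i) \<subset> F"
      using assms(1) i unfolding sparse_repr_def by blast
    then have "card (set (nb i)) < card F"
      by (rule psubset_card_mono[OF finite_F])
    moreover have "card (set (nb i)) = length (nb i)"
      using assms(1) i unfolding sparse_repr_def by (metis distinct_card)
    ultimately show ?thesis using card_V card_F by linarith
  qed
  ultimately have "depth (jacobi k fs nb N b) \<le> 6 + 6 * e + k * (4 + 3 * e)"
    by (rule depth_jacobi)
  then have "real (depth (jacobi k fs nb N b)) \<le> real (6 + 6 * e + k * (4 + 3 * e))"
    by (simp only: of_nat_le_iff)
  also have "\<dots> = 6 + 6 * real e + real k * (4 + 3 * real e)" by simp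
  also have "\<dots> \<le> (6 * real e + 6 * real e) + real k * (4 * real e + 3 * real e)"
    using e by (intro add_mono mult_left_mono) auto
  also have "\<dots> = real e * (12 + 7 * real k)" by (simp add: algebra_simps)
  \<comment> \<open>\<open>12 + 7 k \<le> 12 l + 35 l \<le> 50 l\<close>, and rounding
    \<open>lv \<ge> 1\<close> up costs at most a factor 2; this is the source of 100.\<close>
  also have "\<dots> \<le> (2 * lv) * (50 * l)"
    using e k l lv by (intro mult_mono) auto
  finally show ?thesis by (simp add: k_def l_def lv_def)
qed

text \<open>Accuracy is claimed for every admissible \<open>k\<close>, cost for the least one, as
  extra sweeps cost extra. The conditions \<open>\<epsilon> \<le> 1/2\<close> and
  \<open>card V \<ge> 2\<close> keep both logarithms at least 1. For empty \<open>F\<close> there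
  are no blocks, yet one instruction is still executed, hence \<open>F \<noteq> {}\<close> for the
  work.\<close>

theorem theorem4:
  shows "\<exists>c::real. c > 0 \<and>
    (\<forall>(V::nat set) (M::('r::finite) bmat) (F::nat set) (\<alpha>::real)
       (fs::nat list) (nb::nat \<Rightarrow> nat list).
      finite V \<longrightarrow> bDD V M \<longrightarrow> F \<subseteq> V \<longrightarrow> \<alpha> \<ge> 4 \<longrightarrow>
      alpha_bDD \<alpha> F (submat M F F) \<longrightarrow>
      bmat_invertible F (jacobi_X F (submat M F F)) \<longrightarrow>
      sparse_repr F (submat M F F) fs nb \<longrightarrow>
        (\<forall>(\<epsilon>::real) (k::nat). 0 < \<epsilon> \<longrightarrow> iteration_count \<epsilon> k \<longrightarrow>
          (\<exists>Z \<in> bmats F F.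
            (\<forall>b. result (jacobi k fs nb (submat M F F) b) = bmat_vec F Z b) \<and>
            bmat_invertible F Z \<and>
            loewner_le F (\<lambda>i j. 0) (\<lambda>i j. bmat_inv F Z i j - submat M F F i j) \<and>
            (bmat_invertible (V - F) (submat M (V - F) (V - F)) \<longrightarrow>
              loewner_le F (\<lambda>i j. bmat_inv F Z i j - submat M F F i j)
                (\<lambda>i j. \<epsilon> *\<^sub>R schur V M (V - F) i j)))) \<and>
        (\<forall>(\<epsilon>::real) (k::nat) (b::'r bvec).
          0 < \<epsilon> \<longrightarrow> \<epsilon> \<le> 1 / 2 \<longrightarrow> k = (LEAST k. iteration_count \<epsilon> k) \<longrightarrow>
            (F \<noteq> {} \<longrightarrow> real (work (jacobi k fs nb (submat M F F) b))
               \<le> c * real (nnz_blocks F (submat M F F)) * log 2 (1 / \<epsilon>)) \<and>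
            (card V \<ge> 2 \<longrightarrow> real (depth (jacobi k fs nb (submat M F F) b))
               \<le> c * log 2 (real (card V)) * log 2 (1 / \<epsilon>))))"
proof (rule exI[of _ 100], intro conjI allI impI)
  fix V F \<alpha> fs nb and M :: "'r bmat"
  assume V: "finite V" "bDD V M" "F \<subseteq> V" and \<alpha>: "\<alpha> \<ge> 4" "alpha_bDD \<alpha> F (submat M F F)"
    "bmat_invertible F (jacobi_X F (submat M F F))"
    and repr: "sparse_repr F (submat M F F) fs nb"
  interpret jacobi_splitting F "submat M F F" \<alpha>
  proof
    show "finite F" using V(1,3) by (rule rev_finite_subset)
    show "submat M F F \<in> bmats F F" by (simp add: bmats_def submat_def)
  qed (use \<alpha> in auto)
  {
    fix \<epsilon> k
    assume \<epsilon>: "0 < \<epsilon>" "iteration_count \<epsilon> k"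
    then have "odd k" by (simp add: iteration_count_def)
    show "\<exists>Z \<in> bmats F F.
            (\<forall>b. result (jacobi k fs nb (submat M F F) b) = bmat_vec F Z b) \<and>
            bmat_invertible F Z \<and>
            loewner_le F (\<lambda>i j. 0) (\<lambda>i j. bmat_inv F Z i j - submat M F F i j) \<and>
            (bmat_invertible (V - F) (submat M (V - F) (V - F)) \<longrightarrow>
              loewner_le F (\<lambda>i j. bmat_inv F Z i j - submat M F F i j)
                (\<lambda>i j. \<epsilon> *\<^sub>R schur V M (V - F) i j))"
      by (rule bexI[of _ "Z k"], intro conjI allI impI)
        (simp_all only: result_jacobi[OF repr] Z_invertible[OF \<open>odd k\<close>] residual_nonneg[OF \<open>odd k\<close>]
          residual_le[OF V refl _ \<epsilon>] Z_bmats)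
  }
  fix \<epsilon> :: real and k and b :: "'r bvec"
  assume \<epsilon>: "0 < \<epsilon>" "\<epsilon> \<le> 1 / 2" and k: "k = (LEAST k. iteration_count \<epsilon> k)"
  show "real (work (jacobi k fs nb (submat M F F) b))
      \<le> 100 * real (nnz_blocks F (submat M F F)) * log 2 (1 / \<epsilon>)" if "F \<noteq> {}"
    unfolding k by (rule work_le[OF repr that \<epsilon>])
  show "real (depth (jacobi k fs nb (submat M F F) b))
      \<le> 100 * log 2 (real (card V)) * log 2 (1 / \<epsilon>)" if "card V \<ge> 2"
    unfolding k by (rule depth_le[OF repr V(1,3) that \<epsilon>])
qed simp

end
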